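(* (Frequentist optional stopping for composite null hypotheses with group invariance.) In the group-invariant random process setting described in the context, let $\tau$ be a stopping time with $\bar P_0(\tau=\infty\mid x^m)=\bar P_1(\tau=\infty\mid x^m)=0$ for every $x^m\in\langle\mathcal X^m\rangle$, and such that, for each $n>m$, the event $\{\tau=n\}$ is $\mathcal G_n$-measurable. Let $\beta_\tau=\sum_{j=m+1}^\infty\mathbf 1_{\{\tau=j\}}\beta_j$. Then for all $g\in G$ the stopped Bayes factor satisfies $$\mathbf E_{P_{0,g}}[\beta_\tau]=\int_{\mathbb R_{>0}}c\,\mathrm dP_{0,g}^{[\beta_\tau]}(c)=1,$$ so that for all $g\in G$ and all $0\le\alpha\le1$, $$P_{0,g}\left(\frac1{\beta_\tau}\le\alpha\right)\le\alpha .$$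
   Context: Setting. $\mathcal X$ is a locally compact Hausdorff space and $m>0$ an integer. $\langle\mathcal X^m\rangle\subseteq\mathcal X^m$, and for $n\ge m$, $\langle\mathcal X^n\rangle=\{x^n\in\mathcal X^n:(x_1,\dots,x_m)\in\langle\mathcal X^m\rangle\}$ is assumed locally compact Hausdorff, with Borel $\sigma$-algebra $\mathcal F_n$. $G$ is a locally compact group with identity $e$ and right Haar measure $\nu$ (Borel, positive on nonempty open sets, finite on compact sets, $\nu(A\cdot g)=\nu(A)$). For each $n\ge m$, $G$ acts topologically (continuously) and properly on the right of $\langle\mathcal X^n\rangle$; proper means that the map $(y,g)\mapsto(y\cdot g,y)$ has compact preimages of compact sets. Distributions. For each $n\ge m$, $P^{(n)}_{0,e}$ and $P^{(n)}_{1,e}$ are mutually absolutely continuous probability measures on $(\langle\mathcal X^n\rangle,\mathcal F_n)$. For $k\in\{0,1\}$, $g\in G$: $P^{(n)}_{k,g}(A)=P^{(n)}_{k,e}(A\cdot g^{-1})$, and $\bar P_k^{(n)}(A)=\int_GP^{(n)}_{k,g}(A)\,\nu(\mathrm dg)$ is the Bayes marginal (possibly infinite). Assumptions, for each $n\ge m$: (a) $\bar P_0^{(n)},\bar P_1^{(n)}$ are $\sigma$-finite; (b) $\bar P_0^{(n)},\bar P_1^{(n)}$ and all $P^{(n)}_{k,g}$ are mutually absolutely continuous; (c) $\langle\mathcal X^m\rangle$ has measure $1$ under all these probability distributions (the excluded part of $\mathcal X^m$ is a null set); (d) for all $x^n\in\langle\mathcal X^n\rangle$ the posterior on $G$ based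 on $\nu$, proportional to $\frac{\mathrm dP^{(n)}_{k,g}}{\mathrm d\rho^{(n)}}(x^n)\,\nu(\mathrm dg)$ with $\rho^{(n)}$ a dominating measure mutually absolutely continuous with $\bar P_0^{(n)},\bar P_1^{(n)}$ and all $P^{(n)}_{k,g}$ ($k\in\{0,1\}$, $g\in G$), is a proper probability measure; (e) $P^{(n)}_{k,e}$ and $P^{(n+1)}_{k,e}$ satisfy Kolmogorov's compatibility condition; (f) the group action considered is the same for all $n$: for every $A\in\mathcal F_n$ (viewed also as an event about the first $n$ coordinates), $g\in G$, $k\in\{0,1\}$, $P^{(n+1)}_{k,g}(A)=P^{(n)}_{k,g}(A)$, the action on the first $n$ coordinates of $\langle\mathcal X^{n+1}\rangle$ being the action on $\langle\mathcal X^n\rangle$. Consequently there are a measurable space $(\Omega,\mathcal F)$ with a process $X^n$ ($n\ge m$), taking values in $\langle\mathcal X^n\rangle$ and consisting of an initial sample $\langle X^{(m)}\rangle$ followed by $X_{m+1},X_{m+2},\dots$, probability measures $P_{k,g}$ on $(\Omega,\mathcal F)$ whose marginals for $X^n$ are $P^{(n)}_{k,g}$, and measures $\bar P_k=\int_GP_{k,g}\,\nu(\mathrm dg)$ with marginals $\bar P_k^{(n)}$. $\mathcal F_n$ is identified with the $\sigma$-algebra on $\Omega$ generated by $X^n$. $H_k=\{P_{k,g}:g\in G\}$, with prior probabilities $\pi(H_0)=\pi(H_1)=1/2$. $\bar P_k(\cdot\mid x^m)=\int_GP_{k,g}(\cdot\mid\langle X^{(m)}\rangle=x^m)\,\nu_k(\mathrm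 dg\mid x^m)$, where $\nu_k(\cdot\mid x^m)$ is the posterior in (d) with $n=m$. Quotient $\sigma$-algebra. $\mathcal G_n$ consists of the sets $A\in\mathcal F_n$ that are unions of $G$-orbits, i.e. $A=\varphi^{-1}(\varphi(A))$ with $\varphi:\langle\mathcal X^n\rangle\to\langle\mathcal X^n\rangle/G$ the natural projection (pulled back to $\Omega$ via $X^n$). Bayes factor. $\beta_n=\frac{\mathrm d\bar P_1^{(n)}}{\mathrm d\bar P_0^{(n)}}(X^n)$. A stopping time is a function $\tau:\Omega\to\{m+1,m+2,\dots\}\cup\{\infty\}$ with $\{\tau=n\}\in\mathcal F_n$ for all $n>m$. For a probability measure $P$ on $\Omega$ and random variable $B$, $P^{[B]}(A)=P(B\in A)$ for Borel $A\subseteq\mathbb R_{>0}$. Convention: $1/0=\infty$.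
   Formalization: Added hypothesis: G is unimodular (the right Haar measure ν is also left invariant). Without it the claim fails: P_{1,e}=P_{0,h} with modular function at h not 1 makes β_n a constant ≠ 1. Densities and conditional laws are taken jointly measurable in (g,x). *)

theory Defs
  imports "HOL-Probability.Probability"
begin

subsection \<open>Sample spaces\<close>

definition borel_of :: "'a topology \<Rightarrow> 'a measure" where
  "borel_of T = sigma (topspace T) {U. openin T U}"

text \<open>
  A point \<open>(x_1, \<dots>, x_n)\<close> of the \<open>n\<close>-fold product is an extensional function on \<open>{..<n}\<close>, so the
  coordinate \<open>x_i\<close> is the value at \<open>i - 1\<close> and the first \<open>n\<close> coordinates are
  \<open>restrict x {..<n}\<close>. The set \<open>S\<close> is the admissible part of the \<open>m\<close>-fold product.
\<close>

definition sample_space :: "nat \<Rightarrow> (nat \<Rightarrow> 'x) set \<Rightarrow> nat \<Rightarrow> (nat \<Rightarrow> 'x) set" where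
  "sample_space m S n = {x \<in> {..<n} \<rightarrow>\<^sub>E UNIV. restrict x {..<m} \<in> S}"

definition sample_topology ::
    "nat \<Rightarrow> (nat \<Rightarrow> 'x::topological_space) set \<Rightarrow> nat \<Rightarrow> (nat \<Rightarrow> 'x) topology" where
  "sample_topology m S n =
     subtopology (product_topology (\<lambda>_. euclidean) {..<n}) (sample_space m S n)"

definition sample_algebra ::
    "nat \<Rightarrow> (nat \<Rightarrow> 'x::topological_space) set \<Rightarrow> nat \<Rightarrow> (nat \<Rightarrow> 'x) measure" where
  "sample_algebra m S n = borel_of (sample_topology m S n)"

subsection \<open>Haar measure and group actions\<close>

text \<open>
  Topological groups are types of class \<^class>\<open>topological_group_add\<close>, which does not
  include commutativity: the group law is written \<open>g + h\<close>, the identity \<open>0\<close>, the inverse \<open>- g\<close>.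
\<close>

definition right_haar_measure :: "'g::topological_group_add measure \<Rightarrow> bool" where
  "right_haar_measure \<nu> \<longleftrightarrow>
     sets \<nu> = sets borel \<and>
     (\<forall>U. open U \<longrightarrow> U \<noteq> {} \<longrightarrow> emeasure \<nu> U > 0) \<and>
     (\<forall>C. compact C \<longrightarrow> emeasure \<nu> C < \<infinity>) \<and>
     (\<forall>A \<in> sets borel. \<forall>g. emeasure \<nu> ((\<lambda>h. h + g) ` A) = emeasure \<nu> A)"

text \<open>
  A right Haar measure that is also left invariant, i.e. the group is unimodular. With
  right translates \<open>P_g = law of Y \<cdot> g\<close> (\<open>Y\<close> distributed as \<open>P_e\<close>), replacing the base point \<open>P_e\<close>
  by \<open>P_h\<close> replaces \<open>P_g\<close> by \<open>P_(h g)\<close>. The family \<open>{P_g}\<close> is unchanged, but the mixture over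
  a right Haar measure \<open>\<nu>\<close> is multiplied by the modular function at \<open>h\<close>. So without left
  invariance the Bayes factor of two families depends on the choice of their base points.
\<close>

definition left_invariant :: "'g::topological_group_add measure \<Rightarrow> bool" where
  "left_invariant \<nu> \<longleftrightarrow>
     (\<forall>A \<in> sets borel. \<forall>g. emeasure \<nu> ((\<lambda>h. g + h) ` A) = emeasure \<nu> A)"

definition proper_right_action ::
    "'y topology \<Rightarrow> ('y \<Rightarrow> 'g::topological_group_add \<Rightarrow> 'y) \<Rightarrow> bool" where
  "proper_right_action T act \<longleftrightarrow>
     (\<forall>y \<in> topspace T. act y 0 = y) \<and>
     (\<forall>y \<in> topspace T. \<forall>g h. act (act y g) h = act y (g + h)) \<and>
     continuous_map (prod_topology T euclidean) T (\<lambda>(y, g). act y g) \<and>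
     (\<forall>C. compactin (prod_topology T T) C \<longrightarrow>
        compactin (prod_topology T euclidean) {(y, g). y \<in> topspace T \<and> (act y g, y) \<in> C})"

definition orbit_of :: "('y \<Rightarrow> 'g \<Rightarrow> 'y) \<Rightarrow> 'y \<Rightarrow> 'y set" where
  "orbit_of act y = range (act y)"

text \<open>\<open>orbit_of act\<close> is the natural projection onto the orbit space.\<close>

definition invariant_events :: "'y measure \<Rightarrow> ('y \<Rightarrow> 'g \<Rightarrow> 'y) \<Rightarrow> 'y set set" where
  "invariant_events M act =
     {A \<in> sets M. A = {x \<in> space M. orbit_of act x \<in> orbit_of act ` A}}"

subsection \<open>Models, Bayes marginals, posteriors\<close>

datatype hypothesis = H0 | H1

text \<open>
  By \<open>emeasure_bind\<close>, a measurable family \<open>P\<close> of probability measures satisfies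
  \<open>bayes_marginal \<nu> P (A) = \<integral> P g (A) \<nu>(dg)\<close>; the measure \<open>\<nu>\<close> may be infinite.
\<close>

definition bayes_marginal :: "'g measure \<Rightarrow> ('g \<Rightarrow> 'a measure) \<Rightarrow> 'a measure" where
  "bayes_marginal \<nu> P = \<nu> \<bind> P"

text \<open>
  If the normalising integral is \<open>0\<close> or \<open>\<infinity>\<close>, the arithmetic of \<^typ>\<open>ennreal\<close> makes this the
  null measure, so it is a probability measure iff the integral is positive and finite.
\<close>

definition posterior :: "'g measure \<Rightarrow> ('g \<Rightarrow> 'y \<Rightarrow> ennreal) \<Rightarrow> 'y \<Rightarrow> 'g measure" where
  "posterior \<nu> p x = density \<nu> (\<lambda>g. p g x / (\<integral>\<^sup>+h. p h x \<partial>\<nu>))"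

definition conditional_marginal ::
    "'g measure \<Rightarrow> ('g \<Rightarrow> 'y \<Rightarrow> ennreal) \<Rightarrow> ('g \<Rightarrow> 'y \<Rightarrow> 'w measure) \<Rightarrow> 'y \<Rightarrow> 'w measure" where
  "conditional_marginal \<nu> p K x = posterior \<nu> p x \<bind> (\<lambda>g. K g x)"

definition model_measures ::
    "'g measure \<Rightarrow> (hypothesis \<Rightarrow> 'g \<Rightarrow> 'a measure) \<Rightarrow> 'a measure set" where
  "model_measures \<nu> P = range (\<lambda>k. bayes_marginal \<nu> (P k)) \<union> {P k g | k g. True}"

definition RN_version :: "'a measure \<Rightarrow> 'a measure \<Rightarrow> ('a \<Rightarrow> real) \<Rightarrow> bool" where
  "RN_version M N f \<longleftrightarrow>
     f \<in> borel_measurable M \<and> (\<forall>x \<in> space M. 0 \<le> f x) \<and> density M (\<lambda>x. ennreal (f x)) = N"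

text \<open>
  \<open>P n k g\<close> is the distribution of a sample of size \<open>n\<close>, \<open>\<rho> n\<close> a dominating measure and
  \<open>p n k g\<close> the density of \<open>P n k g\<close>. The excluded part of the \<open>m\<close>-fold product is null because
  all measures live on \<open>sample_space m S n\<close>. The measurability assumptions in the group
  parameter are those needed for the integrals over the group to make sense.
\<close>

locale group_invariant_models =
  fixes m :: nat
    and S :: "(nat \<Rightarrow> 'x::t2_space) set"
    and act :: "nat \<Rightarrow> (nat \<Rightarrow> 'x) \<Rightarrow> 'g::{topological_group_add, t2_space} \<Rightarrow> (nat \<Rightarrow> 'x)"
    and \<nu> :: "'g measure"
    and P :: "nat \<Rightarrow> hypothesis \<Rightarrow> 'g \<Rightarrow> (nat \<Rightarrow> 'x) measure"
    and \<rho> :: "nat \<Rightarrow> (nat \<Rightarrow> 'x) measure"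
    and p :: "nat \<Rightarrow> hypothesis \<Rightarrow> 'g \<Rightarrow> (nat \<Rightarrow> 'x) \<Rightarrow> ennreal"
  assumes m_pos: "m > 0"
    and locally_compact_X: "locally_compact_space (euclidean :: 'x topology)"
    and S_subset: "S \<subseteq> {..<m} \<rightarrow>\<^sub>E UNIV"
    and locally_compact_sample: "n \<ge> m \<Longrightarrow> locally_compact_space (sample_topology m S n)"
    and Hausdorff_sample: "n \<ge> m \<Longrightarrow> Hausdorff_space (sample_topology m S n)"
    and locally_compact_G: "locally_compact_space (euclidean :: 'g topology)"
    and haar: "right_haar_measure \<nu>"
    and action: "n \<ge> m \<Longrightarrow> proper_right_action (sample_topology m S n) (act n)"
    and kernel_P: "n \<ge> m \<Longrightarrow> P n k \<in> \<nu> \<rightarrow>\<^sub>M prob_algebra (sample_algebra m S n)"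
    and P_translate: "n \<ge> m \<Longrightarrow> A \<in> sets (sample_algebra m S n) \<Longrightarrow>
          emeasure (P n k g) A = emeasure (P n k 0) ((\<lambda>x. act n x (- g)) ` A)"
    and sigma_finite: "n \<ge> m \<Longrightarrow> sigma_finite_measure (bayes_marginal \<nu> (P n k))"
    and mutually_ac: "n \<ge> m \<Longrightarrow> M \<in> model_measures \<nu> (P n) \<Longrightarrow> N \<in> model_measures \<nu> (P n) \<Longrightarrow>
          absolutely_continuous M N"
    and sets_\<rho>: "n \<ge> m \<Longrightarrow> sets (\<rho> n) = sets (sample_algebra m S n)"
    and ac_\<rho>: "n \<ge> m \<Longrightarrow> M \<in> model_measures \<nu> (P n) \<Longrightarrow>
          absolutely_continuous (\<rho> n) M \<and> absolutely_continuous M (\<rho> n)"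
    and measurable_p: "n \<ge> m \<Longrightarrow>
          (\<lambda>(g, x). p n k g x) \<in> borel_measurable (\<nu> \<Otimes>\<^sub>M sample_algebra m S n)"
    and density_p: "n \<ge> m \<Longrightarrow> density (\<rho> n) (p n k g) = P n k g"
    and proper_posterior: "n \<ge> m \<Longrightarrow> x \<in> sample_space m S n \<Longrightarrow>
          prob_space (posterior \<nu> (p n k) x)"
    and kolmogorov: "n \<ge> m \<Longrightarrow> A \<in> sets (sample_algebra m S n) \<Longrightarrow>
          emeasure (P (Suc n) k 0) {x \<in> sample_space m S (Suc n). restrict x {..<n} \<in> A}
            = emeasure (P n k 0) A"
    and compatible: "n \<ge> m \<Longrightarrow> A \<in> sets (sample_algebra m S n) \<Longrightarrow>
          emeasure (P (Suc n) k g) {x \<in> sample_space m S (Suc n). restrict x {..<n} \<in> A}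
            = emeasure (P n k g) A"
    and same_action: "n \<ge> m \<Longrightarrow> x \<in> sample_space m S (Suc n) \<Longrightarrow>
          restrict (act (Suc n) x g) {..<n} = act n (restrict x {..<n}) g"

subsection \<open>The process and stopping times\<close>

definition observed :: "(nat \<Rightarrow> 'w \<Rightarrow> 'x) \<Rightarrow> nat \<Rightarrow> 'w \<Rightarrow> (nat \<Rightarrow> 'x)" where
  "observed X n \<omega> = (\<lambda>i\<in>{..<n}. X i \<omega>)"

text \<open>
  \<open>Q k g\<close> is the distribution of the whole process, on the measurable space underlying \<open>\<Omega>\<close>,
  and \<open>K k g x\<close> a version of \<open>Q k g\<close> conditioned on the initial sample being \<open>x\<close>. No particular
  version is singled out.
\<close>

locale group_invariant_process = group_invariant_models m S act \<nu> P \<rho> p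
  for m :: nat
    and S :: "(nat \<Rightarrow> 'x::t2_space) set"
    and act :: "nat \<Rightarrow> (nat \<Rightarrow> 'x) \<Rightarrow> 'g::{topological_group_add, t2_space} \<Rightarrow> (nat \<Rightarrow> 'x)"
    and \<nu> :: "'g measure"
    and P :: "nat \<Rightarrow> hypothesis \<Rightarrow> 'g \<Rightarrow> (nat \<Rightarrow> 'x) measure"
    and \<rho> :: "nat \<Rightarrow> (nat \<Rightarrow> 'x) measure"
    and p :: "nat \<Rightarrow> hypothesis \<Rightarrow> 'g \<Rightarrow> (nat \<Rightarrow> 'x) \<Rightarrow> ennreal" +
  fixes \<Omega> :: "'w measure"
    and X :: "nat \<Rightarrow> 'w \<Rightarrow> 'x"
    and Q :: "hypothesis \<Rightarrow> 'g \<Rightarrow> 'w measure"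
    and K :: "hypothesis \<Rightarrow> 'g \<Rightarrow> (nat \<Rightarrow> 'x) \<Rightarrow> 'w measure"
  assumes measurable_observed: "n \<ge> m \<Longrightarrow> observed X n \<in> \<Omega> \<rightarrow>\<^sub>M sample_algebra m S n"
    and kernel_Q: "Q k \<in> \<nu> \<rightarrow>\<^sub>M prob_algebra \<Omega>"
    and distr_Q: "n \<ge> m \<Longrightarrow> distr (Q k g) (sample_algebra m S n) (observed X n) = P n k g"
    and kernel_K: "(\<lambda>(g, x). K k g x) \<in> (\<nu> \<Otimes>\<^sub>M sample_algebra m S m) \<rightarrow>\<^sub>M prob_algebra \<Omega>"
    and conditional_K: "A \<in> sets \<Omega> \<Longrightarrow> B \<in> sets (sample_algebra m S m) \<Longrightarrow>
          emeasure (Q k g) (A \<inter> observed X m -` B)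
            = (\<integral>\<^sup>+x\<in>B. emeasure (K k g x) A \<partial>P m k g)"

definition is_stopping_time ::
    "nat \<Rightarrow> (nat \<Rightarrow> 'x::topological_space) set \<Rightarrow> 'w measure \<Rightarrow> (nat \<Rightarrow> 'w \<Rightarrow> 'x)
      \<Rightarrow> ('w \<Rightarrow> enat) \<Rightarrow> bool" where
  "is_stopping_time m S \<Omega> X \<tau> \<longleftrightarrow>
     (\<forall>\<omega> \<in> space \<Omega>. \<tau> \<omega> > enat m) \<and>
     (\<forall>n > m. {\<omega> \<in> space \<Omega>. \<tau> \<omega> = enat n}
        \<in> sets (vimage_algebra (space \<Omega>) (observed X n) (sample_algebra m S n)))"

definition quotient_events ::
    "nat \<Rightarrow> (nat \<Rightarrow> 'x::topological_space) set \<Rightarrow> (nat \<Rightarrow> (nat \<Rightarrow> 'x) \<Rightarrow> 'g \<Rightarrow> (nat \<Rightarrow> 'x))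
      \<Rightarrow> 'w measure \<Rightarrow> (nat \<Rightarrow> 'w \<Rightarrow> 'x) \<Rightarrow> nat \<Rightarrow> 'w set set" where
  "quotient_events m S act \<Omega> X n =
     {observed X n -` A \<inter> space \<Omega> | A. A \<in> invariant_events (sample_algebra m S n) (act n)}"

text \<open>At most one term of the series is nonzero, and its value is \<open>0\<close> where \<open>\<tau> = \<infinity>\<close>.\<close>

definition stopped ::
    "nat \<Rightarrow> (nat \<Rightarrow> (nat \<Rightarrow> 'x) \<Rightarrow> real) \<Rightarrow> (nat \<Rightarrow> 'w \<Rightarrow> 'x) \<Rightarrow> ('w \<Rightarrow> enat) \<Rightarrow> 'w \<Rightarrow> real" where
  "stopped m \<beta> X \<tau> \<omega> =
     (\<Sum>i. let j = m + 1 + i in indicator {\<omega>. \<tau> \<omega> = enat j} \<omega> * \<beta> j (observed X j \<omega>))"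

definition positive_law :: "'w measure \<Rightarrow> ('w \<Rightarrow> real) \<Rightarrow> real measure" where
  "positive_law M B = restrict_space (distr M borel B) {0<..}"

end

theory Submission
  imports Defs
begin

text \<open>
  Fix a sample size and write \<open>\<mu>\<close> for the Bayes marginal of \<open>H0\<close>, \<open>w g\<close> and \<open>v g\<close> for the densities of
  \<open>P H0 g\<close> and \<open>P H1 g\<close> with respect to \<open>\<mu>\<close>. Then \<open>w\<close> integrates to \<open>1\<close> over the group at each sample,
  because it is the posterior density, and the integral of \<open>v\<close> over the group is the Bayes factor \<open>\<beta>\<close>.
  Right invariance of the Haar measure \<open>\<nu>\<close> makes \<open>\<mu>\<close> invariant under the action, and the densities
  follow the action: \<open>w (g + a) (x \<cdot> a) = w g x\<close> for \<open>\<mu>\<close>-almost every \<open>x\<close>, likewise for \<open>v\<close>.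

  Let \<open>A\<close> be an invariant event. Writing \<open>\<beta>\<close> as the integral of \<open>v h\<close> and moving the sample by \<open>h\<close>
  replaces \<open>v h\<close>, \<open>w g\<close> by \<open>v 0\<close>, \<open>w (g - h)\<close>. Hence the integral of \<open>\<beta>\<close> over \<open>A\<close> under \<open>P H0 g\<close> equals the
  integral over \<open>A\<close> under \<open>P H1 0\<close> of \<open>W x = (\<integral>\<^sup>+h. w (- h) x \<partial>\<nu>)\<close> (\<open>nn_integral_mixture\<close>). On a unimodular
  group one expects \<open>W = 1\<close>, by inversion invariance of \<open>\<nu>\<close>. The usual proof of that invariance
  integrates over the group twice and requires addition to be jointly measurable, or \<open>\<nu>\<close> to be
  regular. Here it is replaced by an argument on the sample space: left invariance makes \<open>W\<close> almost
  invariant, and the identity just described, with \<open>v\<close> replaced by \<open>w\<close>, shows that \<open>W\<close> has mean \<open>1\<close> under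
  \<open>P H0 0\<close> conditionally on the almost invariant events. A function measurable with respect to these
  events and with conditional mean \<open>1\<close> is \<open>1\<close> (\<open>AE_reflected_eq_1\<close>). So on invariant events \<open>\<beta>\<close> is the
  likelihood ratio of \<open>P H1 0\<close> against every \<open>P H0 g\<close> (\<open>integral_bayes_factor_invariant_event\<close>).

  Since each event \<open>\<tau> = j\<close> is invariant, summing over \<open>j\<close> shows that the expectation of the stopped Bayes
  factor is the probability under \<open>H1\<close> that \<open>\<tau>\<close> is finite (\<open>nn_integral_stopped\<close>). That probability is \<open>1\<close>:
  the assumption on the conditional marginals yields, by Tonelli's theorem, \<open>\<tau> < \<infinity>\<close> almost surely for
  almost every member of \<open>H1\<close>, and by invariance the members agree on this event. The bound for
  \<open>1 / \<beta>\<^sub>\<tau>\<close> is Markov's inequality.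
\<close>

section \<open>Two facts on nonnegative integrals\<close>

lemma nn_integral_eq_imp_AE_eq:
  fixes f g :: "'a \<Rightarrow> ennreal"
  assumes [measurable]: "f \<in> borel_measurable M" "g \<in> borel_measurable M"
    and le: "\<And>x. x \<in> space M \<Longrightarrow> f x \<le> g x"
    and eq: "(\<integral>\<^sup>+x. f x \<partial>M) = (\<integral>\<^sup>+x. g x \<partial>M)" and fin: "(\<integral>\<^sup>+x. g x \<partial>M) \<noteq> \<infinity>"
  shows "AE x in M. f x = g x"
proof -
  have "(\<integral>\<^sup>+x. g x - f x \<partial>M) = (\<integral>\<^sup>+x. g x \<partial>M) - (\<integral>\<^sup>+x. f x \<partial>M)"
    by (rule nn_integral_diff) (use le eq fin in auto)
  also have "\<dots> = 0" using eq fin by (simp add: diff_eq_0_iff_ennreal less_top)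
  finally have "AE x in M. g x - f x = 0"
    by (subst (asm) nn_integral_0_iff_AE) auto
  moreover have "AE x in M. g x \<noteq> \<infinity>"
    by (rule nn_integral_PInf_AE) (use fin in auto)
  ultimately show ?thesis
    using AE_space by eventually_elim (use le in \<open>auto simp: diff_eq_0_iff_ennreal intro: antisym\<close>)
qed

text \<open>
  The measure with density \<open>f\<close> is finite, and \<open>M\<close> has the density \<open>1 / f\<close> with respect to it, which
  is finite almost everywhere.
\<close>

lemma sigma_finite_measureI_integrable:
  fixes f :: "'a \<Rightarrow> ennreal"
  assumes [measurable]: "f \<in> borel_measurable M"
    and pos: "AE x in M. 0 < f x" and fin: "(\<integral>\<^sup>+x. f x \<partial>M) \<noteq> \<infinity>"
  shows "sigma_finite_measure M"
proof -
  interpret N: finite_measure "density M f"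
    by (rule finite_measureI) (use fin in \<open>simp add: emeasure_density cong: nn_integral_cong\<close>)
  have "AE x in M. f x \<noteq> \<infinity>" by (rule nn_integral_PInf_AE) (use fin in auto)
  hence "AE x in M. f x * inverse (f x) = 1"
    using pos by eventually_elim (simp flip: divide_ennreal_def add: less_top[symmetric])
  hence "density M (\<lambda>x. f x * inverse (f x)) = density M (\<lambda>x. 1)"
    by (intro density_cong) auto
  hence "M = density (density M f) (\<lambda>x. inverse (f x))"
    by (simp add: density_density_eq density_1)
  moreover have "AE x in density M f. inverse (f x) \<noteq> \<infinity>"
    by (subst AE_density) auto
  ultimately show ?thesis
    using N.sigma_finite_iff_density_finite[of "\<lambda>x. inverse (f x)"] by simp
qed

section \<open>Equivariant densities under a measure-preserving action\<close>

text \<open>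
  The abstract setting of the main identity: \<open>\<mu>\<close> stands for the Bayes marginal of the null
  hypothesis and \<open>T a\<close> for the action of \<open>a\<close> on samples. Measurability is available only for each
  single map \<open>T a\<close>: if the group is not second countable, the product of its Borel algebra with
  another one can be too small for the action, or for addition as a map of two variables, to be
  jointly measurable. Therefore every interchange of integrals below is applied to the densities,
  whose joint measurability is part of the model.
\<close>

locale bi_invariant_action =
  fixes \<nu> :: "'g::topological_group_add measure" and \<mu> :: "'y measure" and T :: "'g \<Rightarrow> 'y \<Rightarrow> 'y"
  assumes sets_\<nu> [measurable_cong]: "sets \<nu> = sets borel"
    and sigma_finite_\<nu>: "sigma_finite_measure \<nu>"
    and sigma_finite_\<mu>: "sigma_finite_measure \<mu>"
    and distr_right: "distr \<nu> \<nu> (\<lambda>h. h + a) = \<nu>"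
    and distr_left: "distr \<nu> \<nu> (\<lambda>h. a + h) = \<nu>"
    and measurable_T [measurable]: "T a \<in> \<mu> \<rightarrow>\<^sub>M \<mu>"
    and distr_T: "distr \<mu> \<mu> (T a) = \<mu>"
begin

sublocale \<nu>: sigma_finite_measure \<nu> by (rule sigma_finite_\<nu>)
sublocale \<mu>: sigma_finite_measure \<mu> by (rule sigma_finite_\<mu>)
sublocale pair_sigma_finite \<nu> \<mu> ..

lemma space_\<nu> [simp]: "space \<nu> = UNIV"
  using sets_eq_imp_space_eq[OF sets_\<nu>] by simp

lemma measurable_add_right [measurable]: "(\<lambda>h. h + a) \<in> \<nu> \<rightarrow>\<^sub>M \<nu>"
  and measurable_add_left [measurable]: "(\<lambda>h. a + h) \<in> \<nu> \<rightarrow>\<^sub>M \<nu>"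
  and measurable_uminus_group [measurable]: "uminus \<in> \<nu> \<rightarrow>\<^sub>M \<nu>"
  and measurable_diff_group [measurable]: "(\<lambda>h. a - h) \<in> \<nu> \<rightarrow>\<^sub>M \<nu>"
  unfolding measurable_cong_sets[OF sets_\<nu> sets_\<nu>]
  by (intro borel_measurable_continuous_onI continuous_intros)+

lemma nn_integral_right: 
  assumes [measurable]: "f \<in> borel_measurable \<nu>"
  shows "(\<integral>\<^sup>+h. f (h + a) \<partial>\<nu>) = (\<integral>\<^sup>+h. f h \<partial>\<nu>)"
  by (subst (2) distr_right[of a, symmetric]) (simp add: nn_integral_distr)

lemma nn_integral_left: 
  assumes [measurable]: "f \<in> borel_measurable \<nu>"
  shows "(\<integral>\<^sup>+h. f (a + h) \<partial>\<nu>) = (\<integral>\<^sup>+h. f h \<partial>\<nu>)"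
  by (subst (2) distr_left[of a, symmetric]) (simp add: nn_integral_distr)

lemma nn_integral_T: 
  assumes [measurable]: "f \<in> borel_measurable \<mu>"
  shows "(\<integral>\<^sup>+x. f (T a x) \<partial>\<mu>) = (\<integral>\<^sup>+x. f x \<partial>\<mu>)"
  by (subst (2) distr_T[of a, symmetric]) (simp add: nn_integral_distr)

text \<open>
  Densities \<open>w g\<close> with respect to \<open>\<mu>\<close> of probability measures \<open>P g\<close> such that \<open>T a\<close> maps \<open>P g\<close> to
  \<open>P (g + a)\<close>. A density is determined only up to null sets, and the exceptional null set may depend
  on \<open>g\<close> and \<open>a\<close>.
\<close>

definition equivariant :: "('g \<Rightarrow> 'y \<Rightarrow> ennreal) \<Rightarrow> bool" where
  "equivariant w \<longleftrightarrow> (\<lambda>(g, x). w g x) \<in> borel_measurable (\<nu> \<Otimes>\<^sub>M \<mu>) \<and>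
     (\<forall>g a. AE x in \<mu>. w (g + a) (T a x) = w g x)"

definition almost_invariant :: "('y \<Rightarrow> ennreal) \<Rightarrow> bool" where
  "almost_invariant f \<longleftrightarrow> f \<in> borel_measurable \<mu> \<and> (\<forall>a. AE x in \<mu>. f (T a x) = f x)"

lemma equivariantD:
  assumes "equivariant w"
  shows "(\<lambda>(g, x). w g x) \<in> borel_measurable (\<nu> \<Otimes>\<^sub>M \<mu>)"
    and "AE x in \<mu>. w (g + a) (T a x) = w g x"
    and "w g \<in> borel_measurable \<mu>"
proof -
  show *: "(\<lambda>(g, x). w g x) \<in> borel_measurable (\<nu> \<Otimes>\<^sub>M \<mu>)" "AE x in \<mu>. w (g + a) (T a x) = w g x"
    using assms unfolding equivariant_def by auto
  have "g \<in> space \<nu>" using sets_eq_imp_space_eq[OF sets_\<nu>] by simp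
  from measurable_compose[OF measurable_Pair1'[OF this] *(1)]
  show "w g \<in> borel_measurable \<mu>" by simp
qed

lemma equivariant_measurable_compose:
  assumes "equivariant w" "a \<in> N \<rightarrow>\<^sub>M \<nu>" "b \<in> N \<rightarrow>\<^sub>M \<mu>"
  shows "(\<lambda>x. w (a x) (b x)) \<in> borel_measurable N"
  using measurable_compose[OF measurable_Pair[OF assms(2,3)] equivariantD(1)[OF assms(1)]] by simp

text \<open>
  Moving the point by \<open>T h\<close> preserves \<open>\<mu>\<close> and \<open>f\<close> and shifts both group parameters by \<open>- h\<close>.
\<close>

lemma nn_integral_equivariant_shift:
  assumes v: "equivariant v" and w: "equivariant w" and f: "almost_invariant f"
  shows "(\<integral>\<^sup>+x. f x * v h x * w g x \<partial>\<mu>) = (\<integral>\<^sup>+x. f x * v 0 x * w (g - h) x \<partial>\<mu>)"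
proof -
  note [measurable] = equivariantD(3)[OF v] equivariantD(3)[OF w]
  have [measurable]: "f \<in> borel_measurable \<mu>" using f by (simp add: almost_invariant_def)
  have "(\<integral>\<^sup>+x. f x * v h x * w g x \<partial>\<mu>)
      = (\<integral>\<^sup>+x. f (T h x) * v h (T h x) * w g (T h x) \<partial>\<mu>)"
    by (rule nn_integral_T[symmetric]) measurable
  also have "\<dots> = (\<integral>\<^sup>+x. f x * v 0 x * w (g - h) x \<partial>\<mu>)"
  proof (rule nn_integral_cong_AE)
    have "AE x in \<mu>. f (T h x) = f x" using f by (simp add: almost_invariant_def)
    moreover have "AE x in \<mu>. v h (T h x) = v 0 x" using equivariantD(2)[OF v, of 0 h] by simp
    moreover have "AE x in \<mu>. w g (T h x) = w (g - h) x"
      using equivariantD(2)[OF w, of "g - h" h] by simp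
    ultimately show "AE x in \<mu>. f (T h x) * v h (T h x) * w g (T h x) = f x * v 0 x * w (g - h) x"
      by eventually_elim simp
  qed
  finally show ?thesis .
qed

text \<open>
  The mixture is moved from \<open>v\<close> to \<open>w\<close>: after exchanging the integrals, the shift above replaces
  \<open>v h\<close>, \<open>w g\<close> by \<open>v 0\<close>, \<open>w (g - h)\<close>, and right invariance of \<open>\<nu>\<close> removes \<open>g\<close> from \<open>g - h = - (h - g)\<close>.
  The group parameter of \<open>w\<close> then occurs with the opposite sign, so what remains is the integral of
  \<open>w\<close> over the reflected Haar measure.
\<close>

lemma nn_integral_mixture:
  assumes v: "equivariant v" and w: "equivariant w" and f: "almost_invariant f"
  shows "(\<integral>\<^sup>+x. f x * (\<integral>\<^sup>+h. v h x \<partial>\<nu>) * w g x \<partial>\<mu>)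
       = (\<integral>\<^sup>+x. f x * v 0 x * (\<integral>\<^sup>+h. w (- h) x \<partial>\<nu>) \<partial>\<mu>)"
proof -
  note [measurable (raw)] = equivariant_measurable_compose[OF v] equivariant_measurable_compose[OF w]
  have [measurable]: "f \<in> borel_measurable \<mu>" using f by (simp add: almost_invariant_def)
  have "(\<integral>\<^sup>+x. f x * (\<integral>\<^sup>+h. v h x \<partial>\<nu>) * w g x \<partial>\<mu>)
      = (\<integral>\<^sup>+x. (\<integral>\<^sup>+h. f x * v h x * w g x \<partial>\<nu>) \<partial>\<mu>)"
    by (intro nn_integral_cong, subst nn_integral_multc, measurable, subst nn_integral_cmult, measurable)
  also have "\<dots> = (\<integral>\<^sup>+h. (\<integral>\<^sup>+x. f x * v h x * w g x \<partial>\<mu>) \<partial>\<nu>)"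
    by (rule Fubini'[of "\<lambda>h x. f x * v h x * w g x"]) measurable
  also have "\<dots> = (\<integral>\<^sup>+h. (\<integral>\<^sup>+x. f x * v 0 x * w (g - h) x \<partial>\<mu>) \<partial>\<nu>)"
    by (rule nn_integral_cong, rule nn_integral_equivariant_shift[OF v w f])
  also have "\<dots> = (\<integral>\<^sup>+h. (\<lambda>h. \<integral>\<^sup>+x. f x * v 0 x * w (- h) x \<partial>\<mu>) (h + (- g)) \<partial>\<nu>)"
    by (simp add: minus_add)
  also have "\<dots> = (\<integral>\<^sup>+h. (\<integral>\<^sup>+x. f x * v 0 x * w (- h) x \<partial>\<mu>) \<partial>\<nu>)"
    by (rule nn_integral_right) measurable
  also have "\<dots> = (\<integral>\<^sup>+x. (\<integral>\<^sup>+h. f x * v 0 x * w (- h) x \<partial>\<nu>) \<partial>\<mu>)"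
    by (rule Fubini'[of "\<lambda>h x. f x * v 0 x * w (- h) x", symmetric]) measurable
  also have "\<dots> = (\<integral>\<^sup>+x. f x * v 0 x * (\<integral>\<^sup>+h. w (- h) x \<partial>\<nu>) \<partial>\<mu>)"
    by (intro nn_integral_cong, subst nn_integral_cmult, measurable)
  finally show ?thesis .
qed

text \<open>
  This is where left invariance of \<open>\<nu>\<close> enters: moving the point by \<open>a\<close> changes the parameter \<open>- h\<close>
  into \<open>- h - a = - (a + h)\<close>.
\<close>

lemma almost_invariant_reflected:
  assumes w: "equivariant w"
  shows "almost_invariant (\<lambda>x. \<integral>\<^sup>+h. w (- h) x \<partial>\<nu>)"
  unfolding almost_invariant_def
proof (intro conjI allI)
  note [measurable (raw)] = equivariant_measurable_compose[OF w]
  show "(\<lambda>x. \<integral>\<^sup>+h. w (- h) x \<partial>\<nu>) \<in> borel_measurable \<mu>" by measurable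
  fix a
  have "AE h in \<nu>. AE x in \<mu>. w (- h) (T a x) = w (- (a + h)) x"
  proof (rule AE_I2)
    fix h
    show "AE x in \<mu>. w (- h) (T a x) = w (- (a + h)) x"
      using equivariantD(2)[OF w, of "- (a + h)" a] by (simp add: minus_add add.assoc)
  qed
  hence "AE x in \<mu>. AE h in \<nu>. w (- h) (T a x) = w (- (a + h)) x"
    by (subst (asm) AE_commute) measurable
  then show "AE x in \<mu>. (\<integral>\<^sup>+h. w (- h) (T a x) \<partial>\<nu>) = (\<integral>\<^sup>+h. w (- h) x \<partial>\<nu>)"
    using AE_space
  proof eventually_elim
    case (elim x)
    note [measurable] = elim(2)
    have "(\<integral>\<^sup>+h. w (- h) (T a x) \<partial>\<nu>) = (\<integral>\<^sup>+h. (\<lambda>h. w (- h) x) (a + h) \<partial>\<nu>)"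
      by (rule nn_integral_cong_AE) (use elim(1) in simp)
    also have "\<dots> = (\<integral>\<^sup>+h. w (- h) x \<partial>\<nu>)"
      by (rule nn_integral_left) measurable
    finally show ?case .
  qed
qed

text \<open>
  Inversion invariance of \<open>\<nu>\<close> would reduce the claim to the assumption on the mixture. Instead, the
  exchange identity with \<open>v = w\<close> gives that \<open>W x = (\<integral>\<^sup>+h. w (- h) x \<partial>\<nu>)\<close> has the same integral as \<open>1\<close>
  over every almost invariant event, with respect to the measure of density \<open>w 0\<close>. Since \<open>W\<close> is
  itself almost invariant, the events \<open>W \<le> 1\<close> and \<open>W > 1\<close> are admissible, and on each of them the
  equality of the integrals forces \<open>W = 1\<close>.
\<close>

lemma AE_reflected_eq_1:
  assumes w: "equivariant w"
    and mix: "AE x in \<mu>. (\<integral>\<^sup>+h. w h x \<partial>\<nu>) = 1"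
    and pos: "AE x in \<mu>. w 0 x > 0"
    and fin: "(\<integral>\<^sup>+x. w 0 x \<partial>\<mu>) \<noteq> \<infinity>"
  shows "AE x in \<mu>. (\<integral>\<^sup>+h. w (- h) x \<partial>\<nu>) = 1"
proof -
  note [measurable (raw)] = equivariant_measurable_compose[OF w]
  define W where "W x = (\<integral>\<^sup>+h. w (- h) x \<partial>\<nu>)" for x
  have W: "almost_invariant W" unfolding W_def by (rule almost_invariant_reflected[OF w])
  hence [measurable]: "W \<in> borel_measurable \<mu>" by (simp add: almost_invariant_def)
  have key: "(\<integral>\<^sup>+x. indicator B (W x) * w 0 x * W x \<partial>\<mu>) = (\<integral>\<^sup>+x. indicator B (W x) * w 0 x \<partial>\<mu>)"
    if [measurable]: "B \<in> sets borel" for B :: "ennreal set"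
  proof -
    have "almost_invariant (\<lambda>x. indicator B (W x))"
      unfolding almost_invariant_def
    proof (intro conjI allI)
      fix a
      have "AE x in \<mu>. W (T a x) = W x" using W by (simp add: almost_invariant_def)
      then show "AE x in \<mu>. (indicator B (W (T a x)) :: ennreal) = indicator B (W x)"
        by eventually_elim simp
    qed measurable
    from nn_integral_mixture[OF w w this, of 0]
    have "(\<integral>\<^sup>+x. indicator B (W x) * w 0 x * W x \<partial>\<mu>)
        = (\<integral>\<^sup>+x. indicator B (W x) * (\<integral>\<^sup>+h. w h x \<partial>\<nu>) * w 0 x \<partial>\<mu>)"
      by (simp add: W_def)
    also have "\<dots> = (\<integral>\<^sup>+x. indicator B (W x) * w 0 x \<partial>\<mu>)"
      by (rule nn_integral_cong_AE, use mix in eventually_elim) simp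
    finally show ?thesis .
  qed
  have fin': "(\<integral>\<^sup>+x. indicator B (W x) * w 0 x \<partial>\<mu>) \<noteq> \<infinity>" for B
  proof -
    have "(\<integral>\<^sup>+x. indicator B (W x) * w 0 x \<partial>\<mu>) \<le> (\<integral>\<^sup>+x. w 0 x \<partial>\<mu>)"
      by (rule nn_integral_mono) (simp add: indicator_def)
    with fin show ?thesis by (auto simp: top_unique)
  qed
  have "AE x in \<mu>. indicator {..1} (W x) * w 0 x * W x = indicator {..1} (W x) * w 0 x"
  proof (rule nn_integral_eq_imp_AE_eq)
    show "indicator {..1} (W x) * w 0 x * W x \<le> indicator {..1} (W x) * w 0 x" for x
      using mult_left_mono[of "W x" 1 "w 0 x"] by (auto simp: indicator_def)
  qed (use key[of "{..1}"] fin'[of "{..1}"] in auto)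
  moreover have "AE x in \<mu>. indicator {1<..} (W x) * w 0 x = indicator {1<..} (W x) * w 0 x * W x"
  proof (rule nn_integral_eq_imp_AE_eq)
    show "indicator {1<..} (W x) * w 0 x \<le> indicator {1<..} (W x) * w 0 x * W x" for x
      using mult_left_mono[of 1 "W x" "w 0 x"] by (auto simp: indicator_def)
  qed (use key[of "{1<..}"] fin'[of "{1<..}"] in auto)
  moreover have "AE x in \<mu>. w 0 x \<noteq> \<infinity>" by (rule nn_integral_PInf_AE) (use fin in auto)
  ultimately have "AE x in \<mu>. W x = 1"
    using pos
  proof eventually_elim
    case (elim x)
    hence "w 0 x * W x = w 0 x * 1" by (cases "W x \<le> 1") simp_all
    with elim show ?case by (subst (asm) ennreal_mult_cancel_left) auto
  qed
  then show ?thesis unfolding W_def .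
qed

text \<open>
  With \<open>v g\<close> and \<open>w g\<close> the densities of \<open>P H1 g\<close> and \<open>P H0 g\<close> with respect to the Bayes marginal
  \<open>\<mu>\<close> of \<open>H0\<close>, the integral of \<open>v\<close> over the group is the Bayes factor. The identity says that on almost
  invariant functions the Bayes factor is a density of \<open>P H1 0\<close> with respect to every \<open>P H0 g\<close>.
\<close>

lemma nn_integral_bayes_factor:
  assumes v: "equivariant v" and w: "equivariant w" and f: "almost_invariant f"
    and mix: "AE x in \<mu>. (\<integral>\<^sup>+h. w h x \<partial>\<nu>) = 1"
    and pos: "AE x in \<mu>. w 0 x > 0"
    and fin: "(\<integral>\<^sup>+x. w 0 x \<partial>\<mu>) \<noteq> \<infinity>"
  shows "(\<integral>\<^sup>+x. f x * (\<integral>\<^sup>+h. v h x \<partial>\<nu>) * w g x \<partial>\<mu>) = (\<integral>\<^sup>+x. f x * v 0 x \<partial>\<mu>)"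
  unfolding nn_integral_mixture[OF v w f]
  by (rule nn_integral_cong_AE, use AE_reflected_eq_1[OF w mix pos fin] in eventually_elim) simp

end

section \<open>Bayes factors of group-invariant models\<close>

lemma orbit_of_act:
  assumes "proper_right_action T act" "y \<in> topspace T"
  shows "orbit_of act (act y a) = orbit_of act y"
proof -
  have "act (act y a) g = act y (a + g)" for g
    using assms by (auto simp: proper_right_action_def)
  hence "orbit_of act (act y a) = (\<lambda>g. act y (a + g)) ` UNIV"
    by (simp add: orbit_of_def)
  also have "\<dots> = act y ` ((\<lambda>g. a + g) ` UNIV)" by (simp only: image_image)
  also have "(\<lambda>g. a + g) ` UNIV = UNIV"
    by (metis add_minus_cancel surjI)
  finally show ?thesis by (simp add: orbit_of_def)
qed

context group_invariant_models
begin

abbreviation "\<F> n \<equiv> sample_algebra m S n"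
abbreviation "marginal n k \<equiv> bayes_marginal \<nu> (P n k)"

lemma sets_\<nu> [measurable_cong]: "sets \<nu> = sets borel"
  using haar by (simp add: right_haar_measure_def)

lemma space_\<nu> [simp]: "space \<nu> = UNIV"
  using sets_eq_imp_space_eq[OF sets_\<nu>] by simp

lemma measurable_translations:
  shows "(\<lambda>h. h + a) \<in> \<nu> \<rightarrow>\<^sub>M \<nu>" "(\<lambda>h. a + h) \<in> \<nu> \<rightarrow>\<^sub>M \<nu>"
  unfolding measurable_cong_sets[OF sets_\<nu> sets_\<nu>]
  by (intro borel_measurable_continuous_onI continuous_intros)+

lemma distr_\<nu>_right: "distr \<nu> \<nu> (\<lambda>h. h + a) = \<nu>"
proof (rule measure_eqI)
  fix A assume "A \<in> sets (distr \<nu> \<nu> (\<lambda>h. h + a))"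
  hence A: "A \<in> sets borel" by (simp add: sets_\<nu>)
  have "(\<lambda>h. h + a) -` A = (\<lambda>h. h + - a) ` A"
    by (intro set_eqI) (simp add: image_iff bex_simps eq_diff_eq)
  moreover have "emeasure \<nu> ((\<lambda>h. h + - a) ` A) = emeasure \<nu> A"
    using haar A unfolding right_haar_measure_def by blast
  ultimately have "emeasure \<nu> ((\<lambda>h. h + a) -` A) = emeasure \<nu> A" by simp
  with A measurable_translations(1)[of a] show "emeasure (distr \<nu> \<nu> (\<lambda>h. h + a)) A = emeasure \<nu> A"
    by (simp add: emeasure_distr sets_\<nu>)
qed simp

lemma distr_\<nu>_left: 
  assumes "left_invariant \<nu>"
  shows "distr \<nu> \<nu> (\<lambda>h. a + h) = \<nu>"
proof (rule measure_eqI)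
  fix A assume "A \<in> sets (distr \<nu> \<nu> (\<lambda>h. a + h))"
  hence A: "A \<in> sets borel" by (simp add: sets_\<nu>)
  have "(\<lambda>h. a + h) -` A = (\<lambda>h. - a + h) ` A"
    by (force simp: image_iff add.assoc[symmetric])
  with A measurable_translations(2)[of a] show "emeasure (distr \<nu> \<nu> (\<lambda>h. a + h)) A = emeasure \<nu> A"
    using assms by (simp add: emeasure_distr sets_\<nu> left_invariant_def)
qed simp

lemma topspace_sample_topology: "topspace (sample_topology m S n) = sample_space m S n"
  by (auto simp: sample_topology_def sample_space_def topspace_subtopology)

lemma space_\<F> [simp]: "space (\<F> n) = sample_space m S n"
  by (simp add: sample_algebra_def borel_of_def topspace_sample_topology space_measure_of_conv)

lemma act_space:
  assumes "n \<ge> m" "x \<in> sample_space m S n"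
  shows "act n x a \<in> sample_space m S n"
proof -
  have "continuous_map (prod_topology (sample_topology m S n) euclidean) (sample_topology m S n)
      (\<lambda>(y, g). act n y g)"
    using action[OF assms(1)] by (simp add: proper_right_action_def)
  from continuous_map_image_subset_topspace[OF this] show ?thesis
    using assms(2) by (auto simp: topspace_sample_topology image_subset_iff)
qed

lemma act_0: "n \<ge> m \<Longrightarrow> x \<in> sample_space m S n \<Longrightarrow> act n x 0 = x"
  and act_act: "n \<ge> m \<Longrightarrow> x \<in> sample_space m S n \<Longrightarrow> act n (act n x g) h = act n x (g + h)"
  using action[of n] by (auto simp: proper_right_action_def topspace_sample_topology)

lemma measurable_act:
  assumes n: "n \<ge> m"
  shows "(\<lambda>x. act n x a) \<in> \<F> n \<rightarrow>\<^sub>M \<F> n"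
proof -
  let ?T = "sample_topology m S n"
  have "continuous_map (prod_topology ?T euclidean) ?T (\<lambda>(y, g). act n y g)"
    using action[OF n] by (simp add: proper_right_action_def)
  moreover have "continuous_map ?T (prod_topology ?T euclidean) (\<lambda>x. (x, a))"
    by (simp add: continuous_map_pairwise o_def)
  ultimately have "continuous_map ?T ?T ((\<lambda>(y, g). act n y g) \<circ> (\<lambda>x. (x, a)))"
    by (rule continuous_map_compose[rotated])
  hence cont: "continuous_map ?T ?T (\<lambda>x. act n x a)" by (simp add: o_def)
  have *: "\<F> n = sigma (topspace ?T) {U. openin ?T U}"
    by (simp add: sample_algebra_def borel_of_def)
  have sub: "{U. openin ?T U} \<subseteq> Pow (topspace ?T)" using openin_subset by auto
  show ?thesis
    unfolding *
  proof (rule measurable_measure_of)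
    fix U assume U: "U \<in> {U. openin ?T U}"
    have "{x \<in> topspace ?T. act n x a \<in> U} \<in> {U. openin ?T U}"
      using openin_continuous_map_preimage[OF cont, of U] U by simp
    moreover have "(\<lambda>x. act n x a) -` U \<inter> space (sigma (topspace ?T) {U. openin ?T U})
        = {x \<in> topspace ?T. act n x a \<in> U}"
      by (auto simp: space_measure_of_conv)
    ultimately show "(\<lambda>x. act n x a) -` U \<inter> space (sigma (topspace ?T) {U. openin ?T U})
        \<in> sets (sigma (topspace ?T) {U. openin ?T U})"
      using sub by (auto intro: sigma_sets.Basic)
  qed (use sub cont in \<open>auto simp: space_measure_of_conv continuous_map_def\<close>)
qed

lemma prob_space_P: "n \<ge> m \<Longrightarrow> prob_space (P n k g)"
  and sets_P: "n \<ge> m \<Longrightarrow> sets (P n k g) = sets (\<F> n)"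
  using measurable_space[OF kernel_P[of n k], of g] by (auto simp: space_prob_algebra)

lemma space_P: "n \<ge> m \<Longrightarrow> space (P n k g) = sample_space m S n"
  using sets_eq_imp_space_eq[OF sets_P[of n k g]] by simp

text \<open>
  The event that \<open>x \<cdot> a\<close> lies in \<open>A\<close> is the translate \<open>A \<cdot> (- a)\<close>, so its probability under \<open>P g\<close> is that of
  \<open>A \<cdot> (- a) \<cdot> (- g) = A \<cdot> (- (g + a))\<close> under \<open>P 0\<close>.
\<close>

lemma emeasure_P_act:
  assumes n: "n \<ge> m" and A: "A \<in> sets (\<F> n)"
  shows "emeasure (P n k g) {x \<in> sample_space m S n. act n x a \<in> A} = emeasure (P n k (g + a)) A"
proof -
  have A': "A \<subseteq> sample_space m S n" using sets.sets_into_space[OF A] by simp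
  have meas: "{x \<in> sample_space m S n. act n x a \<in> A} \<in> sets (\<F> n)"
    using measurable_sets[OF measurable_act[OF n] A, of a] by (simp add: vimage_def Int_def conj_commute)
  have "(\<lambda>x. act n x (- g)) ` {x \<in> sample_space m S n. act n x a \<in> A}
      = (\<lambda>x. act n x (- (g + a))) ` A" (is "?f ` ?L = ?h ` A")
  proof (intro equalityI image_subsetI)
    fix x assume x: "x \<in> ?L"
    hence "?f x = ?h (act n x a)" by (simp add: act_act n minus_add add_diff_eq)
    thus "?f x \<in> ?h ` A" using x by blast
  next
    fix z assume z: "z \<in> A"
    hence z': "z \<in> sample_space m S n" using A' by auto
    have "?h z = ?f (act n z (- a))" using z' by (simp add: act_act n minus_add)
    moreover have "act n z (- a) \<in> ?L" using z z' by (simp add: act_act n act_0 act_space)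
    ultimately show "?h z \<in> ?f ` ?L" by blast
  qed
  thus ?thesis using P_translate[OF n meas, of k g] P_translate[OF n A, of k "g + a"] by simp
qed

text \<open>
  An invariant event cannot distinguish the members of one hypothesis.
\<close>

lemma emeasure_P_invariant_event:
  assumes n: "n \<ge> m" and A: "A \<in> invariant_events (\<F> n) (act n)"
  shows "emeasure (P n k g) A = emeasure (P n k 0) A"
    and "x \<in> sample_space m S n \<Longrightarrow> act n x a \<in> A \<longleftrightarrow> x \<in> A"
proof -
  have *: "A \<in> sets (\<F> n)" "A = {x \<in> sample_space m S n. orbit_of (act n) x \<in> orbit_of (act n) ` A}"
    using A by (auto simp: invariant_events_def)
  show inv: "act n x a \<in> A \<longleftrightarrow> x \<in> A" if x: "x \<in> sample_space m S n" for x a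
    using x act_space[OF n x, of a] orbit_of_act[OF action[OF n], of x a]
    by (subst *(2), subst (2) *(2)) (simp add: topspace_sample_topology)
  have "{x \<in> sample_space m S n. act n x g \<in> A} = A"
    using inv sets.sets_into_space[OF *(1)] by auto
  with emeasure_P_act[OF n *(1), of k 0 g] show "emeasure (P n k g) A = emeasure (P n k 0) A" by simp
qed

lemma kernel_P_subprob: "n \<ge> m \<Longrightarrow> P n k \<in> \<nu> \<rightarrow>\<^sub>M subprob_algebra (\<F> n)"
  using kernel_P by (rule measurable_prob_algebraD)

lemma sets_marginal: "n \<ge> m \<Longrightarrow> sets (marginal n k) = sets (\<F> n)"
  unfolding bayes_marginal_def by (rule sets_bind) (auto simp: sets_P)

lemma emeasure_marginal:
  "n \<ge> m \<Longrightarrow> A \<in> sets (\<F> n) \<Longrightarrow> emeasure (marginal n k) A = (\<integral>\<^sup>+g. emeasure (P n k g) A \<partial>\<nu>)"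
  unfolding bayes_marginal_def by (rule emeasure_bind[OF _ kernel_P_subprob]) auto

text \<open>
  The Haar measure inherits \<open>\<sigma>\<close>-finiteness from the Bayes marginal: a strictly positive function
  with finite integral under the mixture has expectations under the \<open>P g\<close> that are strictly positive
  and integrable over the group. On a general locally compact group a Haar measure need not be
  \<open>\<sigma>\<close>-finite, and Tonelli's theorem depends on it.
\<close>

lemma sigma_finite_\<nu>: "sigma_finite_measure \<nu>"
proof -
  note [measurable_cong] = sets_marginal[OF order_refl, of H0]
  note [measurable] = kernel_P_subprob[OF order_refl, of H0]
  interpret sigma_finite_measure "marginal m H0" by (rule sigma_finite) simp
  obtain h where h [measurable]: "h \<in> borel_measurable (marginal m H0)"
    and fin: "integral\<^sup>N (marginal m H0) h \<noteq> \<infinity>"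
    and pos: "\<And>x. x \<in> space (marginal m H0) \<Longrightarrow> 0 < h x"
    using Ex_finite_integrable_function by blast
  have hm [measurable]: "h \<in> borel_measurable (\<F> m)"
    using h by (simp add: measurable_cong_sets[OF sets_marginal[OF order_refl] refl])
  show ?thesis
  proof (rule sigma_finite_measureI_integrable)
    show "(\<lambda>g. \<integral>\<^sup>+x. h x \<partial>P m H0 g) \<in> borel_measurable \<nu>"
      by measurable
    show "(\<integral>\<^sup>+g. \<integral>\<^sup>+x. h x \<partial>P m H0 g \<partial>\<nu>) \<noteq> \<infinity>"
      using fin unfolding bayes_marginal_def
      by (subst (asm) nn_integral_bind[OF hm kernel_P_subprob]) auto
    show "AE g in \<nu>. 0 < (\<integral>\<^sup>+x. h x \<partial>P m H0 g)"
    proof (rule AE_I2)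
      fix g
      interpret P: prob_space "P m H0 g" by (rule prob_space_P) simp
      have hP: "h \<in> borel_measurable (P m H0 g)"
        using hm by (simp add: measurable_cong_sets[OF sets_P[OF order_refl] refl])
      have "h x > 0" if "x \<in> space (P m H0 g)" for x
        using that pos sets_eq_imp_space_eq[OF sets_marginal[OF order_refl, of H0]] by (simp add: space_P)
      hence "\<not> (AE x in P m H0 g. h x = 0)"
        using P.AE_False by (subst AE_cong[of _ _ "\<lambda>_. False"]) (auto, metis less_irrefl)
      thus "0 < (\<integral>\<^sup>+x. h x \<partial>P m H0 g)"
        using nn_integral_0_iff_AE[OF hP] by (simp add: zero_less_iff_neq_zero)
    qed
  qed
qed

lemma measurable_p_compose:
  assumes "n \<ge> m" "a \<in> N \<rightarrow>\<^sub>M \<nu>" "b \<in> N \<rightarrow>\<^sub>M \<F> n"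
  shows "(\<lambda>x. p n k (a x) (b x)) \<in> borel_measurable N"
  using measurable_compose[OF measurable_Pair[OF assms(2,3)] measurable_p[OF assms(1)]] by simp

lemma sigma_finite_\<rho>:
  assumes n: "n \<ge> m"
  shows "sigma_finite_measure (\<rho> n)"
proof -
  note [measurable (raw)] = measurable_p_compose[OF n]
  note [measurable_cong] = sets_\<rho>[OF n]
  interpret P: prob_space "P n H0 0" using n by (rule prob_space_P)
  have p [measurable]: "p n H0 0 \<in> borel_measurable (\<rho> n)" by measurable
  show ?thesis
  proof (rule sigma_finite_measureI_integrable[OF p])
    have pos: "AE x in P n H0 0. 0 < p n H0 0 x"
      unfolding density_p[OF n, symmetric] by (subst AE_density[OF p]) auto
    have "absolutely_continuous (P n H0 0) (\<rho> n)"
      using ac_\<rho>[OF n, of "P n H0 0"] by (auto simp: model_measures_def)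
    from absolutely_continuous_AE[OF _ this pos] show "AE x in \<rho> n. 0 < p n H0 0 x"
      by (simp add: sets_P sets_\<rho> n)
    have "(\<integral>\<^sup>+x. p n H0 0 x \<partial>\<rho> n) = emeasure (density (\<rho> n) (p n H0 0)) (space (\<rho> n))"
      by (simp add: emeasure_density cong: nn_integral_cong)
    also have "\<dots> = 1"
      unfolding density_p[OF n] using P.emeasure_space_1
      by (simp add: space_P n sets_eq_imp_space_eq[OF sets_\<rho>[OF n]])
    finally show "(\<integral>\<^sup>+x. p n H0 0 x \<partial>\<rho> n) \<noteq> \<infinity>" by simp
  qed
qed

text \<open>
  A posterior density with normaliser \<open>0\<close> or \<open>\<infinity>\<close> vanishes almost everywhere, so a posterior of total
  mass \<open>1\<close> at every sample excludes both values everywhere.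
\<close>

lemma posterior_normaliser:
  assumes n: "n \<ge> m" and x: "x \<in> sample_space m S n"
  shows "(\<integral>\<^sup>+h. p n k h x \<partial>\<nu>) \<noteq> 0" "(\<integral>\<^sup>+h. p n k h x \<partial>\<nu>) \<noteq> \<infinity>"
    "(\<integral>\<^sup>+g. p n k g x / (\<integral>\<^sup>+h. p n k h x \<partial>\<nu>) \<partial>\<nu>) = 1"
proof -
  note [measurable (raw)] = measurable_p_compose[OF n]
  note [measurable] = x[folded space_\<F>]
  let ?r = "\<integral>\<^sup>+h. p n k h x \<partial>\<nu>"
  interpret prob_space "posterior \<nu> (p n k) x" using n x by (rule proper_posterior)
  show 1: "(\<integral>\<^sup>+g. p n k g x / ?r \<partial>\<nu>) = 1"
    using emeasure_space_1 by (simp add: posterior_def emeasure_density cong: nn_integral_cong)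
  have 2: "(\<integral>\<^sup>+g. p n k g x / ?r \<partial>\<nu>) = ?r / ?r"
    by (rule nn_integral_divide) measurable
  show "?r \<noteq> 0" "?r \<noteq> \<infinity>" using 1 unfolding 2 by auto
qed


text \<open>
  For \<open>H0\<close> this is the density of the posterior with respect to the Haar measure; as a function of the
  sample it is also the density of \<open>P n k g\<close> with respect to the Bayes marginal of \<open>H0\<close>, for both
  hypotheses. Hence the normaliser is that of \<open>H0\<close> whatever \<open>k\<close> is.
\<close>

definition posterior_density :: "nat \<Rightarrow> hypothesis \<Rightarrow> 'g \<Rightarrow> (nat \<Rightarrow> 'x) \<Rightarrow> ennreal" where
  "posterior_density n k g x = p n k g x / (\<integral>\<^sup>+h. p n H0 h x \<partial>\<nu>)"

lemma measurable_posterior_density: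
  assumes "n \<ge> m" "a \<in> N \<rightarrow>\<^sub>M \<nu>" "b \<in> N \<rightarrow>\<^sub>M \<F> n"
  shows "(\<lambda>x. posterior_density n k (a x) (b x)) \<in> borel_measurable N"
proof -
  interpret sigma_finite_measure \<nu> by (rule sigma_finite_\<nu>)
  note [measurable (raw)] = measurable_p_compose[OF assms(1)]
  note [measurable] = assms(2,3)
  show ?thesis unfolding posterior_density_def by measurable
qed

lemma marginal_eq_density:
  assumes n: "n \<ge> m"
  shows "marginal n k = density (\<rho> n) (\<lambda>x. \<integral>\<^sup>+h. p n k h x \<partial>\<nu>)"
proof (rule measure_eqI)
  interpret \<nu>: sigma_finite_measure \<nu> by (rule sigma_finite_\<nu>)
  interpret \<rho>: sigma_finite_measure "\<rho> n" using n by (rule sigma_finite_\<rho>)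
  interpret pair_sigma_finite \<nu> "\<rho> n" ..
  note [measurable (raw)] = measurable_p_compose[OF n]
  note [measurable_cong] = sets_\<rho>[OF n]
  show "sets (marginal n k) = sets (density (\<rho> n) (\<lambda>x. \<integral>\<^sup>+h. p n k h x \<partial>\<nu>))"
    using n by (simp add: sets_marginal sets_\<rho>)
  fix A assume "A \<in> sets (marginal n k)"
  hence A [measurable]: "A \<in> sets (\<F> n)" using n by (simp add: sets_marginal)
  have "emeasure (marginal n k) A = (\<integral>\<^sup>+g. emeasure (density (\<rho> n) (p n k g)) A \<partial>\<nu>)"
    using n A by (simp add: emeasure_marginal density_p)
  also have "\<dots> = (\<integral>\<^sup>+g. \<integral>\<^sup>+x. p n k g x * indicator A x \<partial>\<rho> n \<partial>\<nu>)"
    by (intro nn_integral_cong emeasure_density) measurable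
  also have "\<dots> = (\<integral>\<^sup>+x. \<integral>\<^sup>+g. p n k g x * indicator A x \<partial>\<nu> \<partial>\<rho> n)"
    by (rule Fubini'[of "\<lambda>g x. p n k g x * indicator A x", symmetric]) measurable
  also have "\<dots> = (\<integral>\<^sup>+x. (\<integral>\<^sup>+g. p n k g x \<partial>\<nu>) * indicator A x \<partial>\<rho> n)"
  proof (intro nn_integral_cong nn_integral_multc)
    fix x assume "x \<in> space (\<rho> n)"
    hence [measurable]: "x \<in> space (\<F> n)" using sets_eq_imp_space_eq[OF sets_\<rho>[OF n]] by simp
    show "(\<lambda>g. p n k g x) \<in> borel_measurable \<nu>" by measurable
  qed
  also have "\<dots> = emeasure (density (\<rho> n) (\<lambda>x. \<integral>\<^sup>+h. p n k h x \<partial>\<nu>)) A"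
    by (rule emeasure_density[symmetric]) measurable
  finally show "emeasure (marginal n k) A = emeasure (density (\<rho> n) (\<lambda>x. \<integral>\<^sup>+h. p n k h x \<partial>\<nu>)) A" .
qed

lemma space_marginal: "n \<ge> m \<Longrightarrow> space (marginal n k) = sample_space m S n"
  using sets_eq_imp_space_eq[OF sets_marginal] by simp

lemma normaliser_cancel:
  assumes "n \<ge> m" "x \<in> sample_space m S n"
  shows "(\<integral>\<^sup>+h. p n H0 h x \<partial>\<nu>) * (y / (\<integral>\<^sup>+h. p n H0 h x \<partial>\<nu>)) = y"
proof -
  let ?r = "\<integral>\<^sup>+h. p n H0 h x \<partial>\<nu>"
  have "?r \<noteq> 0" "?r < \<infinity>" using posterior_normaliser[OF assms] by (auto simp: less_top)
  hence "?r / ?r = 1" by (intro ennreal_divide_self) auto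
  hence "?r * inverse ?r = 1" by (simp add: divide_ennreal_def)
  thus ?thesis by (simp add: divide_ennreal_def mult.left_commute)
qed

lemma density_marginal_posterior_density:
  assumes n: "n \<ge> m"
  shows "density (marginal n H0) (posterior_density n k g) = P n k g"
    and "density (marginal n H0) (\<lambda>x. \<integral>\<^sup>+h. posterior_density n k h x \<partial>\<nu>) = marginal n k"
proof -
  interpret \<nu>: sigma_finite_measure \<nu> by (rule sigma_finite_\<nu>)
  note [measurable (raw)] = measurable_p_compose[OF n] measurable_posterior_density[OF n]
  note [measurable_cong] = sets_\<rho>[OF n]
  have space: "x \<in> sample_space m S n" if "x \<in> space (\<rho> n)" for x
    using that sets_eq_imp_space_eq[OF sets_\<rho>[OF n]] by simp
  have "density (marginal n H0) (posterior_density n k g)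
      = density (\<rho> n) (\<lambda>x. (\<integral>\<^sup>+h. p n H0 h x \<partial>\<nu>) * posterior_density n k g x)"
    unfolding marginal_eq_density[OF n] by (rule density_density_eq) measurable
  also have "\<dots> = density (\<rho> n) (p n k g)"
  proof (intro density_cong AE_I2)
    fix x assume "x \<in> space (\<rho> n)"
    then show "(\<integral>\<^sup>+h. p n H0 h x \<partial>\<nu>) * posterior_density n k g x = p n k g x"
      unfolding posterior_density_def by (intro normaliser_cancel n space)
  qed measurable
  finally show "density (marginal n H0) (posterior_density n k g) = P n k g"
    by (simp add: density_p n)
  have "density (marginal n H0) (\<lambda>x. \<integral>\<^sup>+h. posterior_density n k h x \<partial>\<nu>)
      = density (\<rho> n) (\<lambda>x. (\<integral>\<^sup>+h. p n H0 h x \<partial>\<nu>) * (\<integral>\<^sup>+h. posterior_density n k h x \<partial>\<nu>))"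
    unfolding marginal_eq_density[OF n, of H0] by (rule density_density_eq) measurable
  also have "\<dots> = density (\<rho> n) (\<lambda>x. \<integral>\<^sup>+h. p n k h x \<partial>\<nu>)"
  proof (intro density_cong AE_I2)
    fix x assume "x \<in> space (\<rho> n)"
    hence x: "x \<in> sample_space m S n" by (rule space)
    hence [measurable]: "x \<in> space (\<F> n)" by simp
    have "(\<integral>\<^sup>+h. posterior_density n k h x \<partial>\<nu>) = (\<integral>\<^sup>+h. p n k h x \<partial>\<nu>) / (\<integral>\<^sup>+h. p n H0 h x \<partial>\<nu>)"
      unfolding posterior_density_def by (rule nn_integral_divide) measurable
    thus "(\<integral>\<^sup>+h. p n H0 h x \<partial>\<nu>) * (\<integral>\<^sup>+h. posterior_density n k h x \<partial>\<nu>) = (\<integral>\<^sup>+h. p n k h x \<partial>\<nu>)"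
      using normaliser_cancel[OF n x] by simp
  qed measurable
  finally show "density (marginal n H0) (\<lambda>x. \<integral>\<^sup>+h. posterior_density n k h x \<partial>\<nu>) = marginal n k"
    by (simp add: marginal_eq_density[OF n, of k])
qed

text \<open>
  The action by \<open>a\<close> permutes the components of the mixture by \<open>g \<mapsto> g + a\<close>, which preserves the right
  Haar measure.
\<close>

lemma distr_marginal_act:
  assumes n: "n \<ge> m"
  shows "distr (marginal n k) (marginal n k) (\<lambda>x. act n x a) = marginal n k"
proof (rule measure_eqI)
  note [measurable] = kernel_P_subprob[OF n]
  fix A assume "A \<in> sets (distr (marginal n k) (marginal n k) (\<lambda>x. act n x a))"
  hence A [measurable]: "A \<in> sets (\<F> n)" using n by (simp add: sets_marginal)
  have T: "(\<lambda>x. act n x a) \<in> marginal n k \<rightarrow>\<^sub>M marginal n k"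
    using measurable_act[OF n] by (simp add: measurable_cong_sets[OF sets_marginal[OF n] sets_marginal[OF n]])
  have A': "{x \<in> sample_space m S n. act n x a \<in> A} \<in> sets (\<F> n)"
    using measurable_sets[OF measurable_act[OF n] A, of a] by (simp add: vimage_def Int_def conj_commute)
  have "emeasure (distr (marginal n k) (marginal n k) (\<lambda>x. act n x a)) A
      = emeasure (marginal n k) {x \<in> sample_space m S n. act n x a \<in> A}"
    using T A by (simp add: emeasure_distr sets_marginal space_marginal n vimage_def Int_def conj_commute)
  also have "\<dots> = (\<integral>\<^sup>+g. emeasure (P n k (g + a)) A \<partial>\<nu>)"
    unfolding emeasure_marginal[OF n A'] emeasure_P_act[OF n A] ..
  also have "\<dots> = (\<integral>\<^sup>+g. emeasure (P n k g) A \<partial>distr \<nu> \<nu> (\<lambda>h. h + a))"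
    by (rule nn_integral_distr[symmetric]) (use measurable_translations(1) in measurable)
  finally show "emeasure (distr (marginal n k) (marginal n k) (\<lambda>x. act n x a)) A = emeasure (marginal n k) A"
    by (simp add: distr_\<nu>_right emeasure_marginal n A)
qed simp

text \<open>
  The main step: on invariant events the Bayes factor is the likelihood ratio of \<open>P n H1 0\<close> against
  every member of the null hypothesis. It remains to place the densities in the abstract setting;
  their equivariance holds because both sides are densities of the same measure with respect to
  the \<open>\<sigma>\<close>-finite marginal.
\<close>

lemma integral_bayes_factor_invariant_event:
  assumes n: "n \<ge> m" and left: "left_invariant \<nu>"
    and \<beta>: "RN_version (marginal n H0) (marginal n H1) \<beta>"
    and A: "A \<in> invariant_events (\<F> n) (act n)"
  shows "(\<integral>\<^sup>+x. indicator A x * ennreal (\<beta> x) \<partial>P n H0 g) = emeasure (P n H1 0) A"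
proof -
  let ?w = "posterior_density n"
  have meas_act: "(\<lambda>x. act n x a) \<in> marginal n H0 \<rightarrow>\<^sub>M marginal n H0" for a
    using measurable_act[OF n] by (simp add: measurable_cong_sets[OF sets_marginal[OF n] sets_marginal[OF n]])
  interpret bi_invariant_action \<nu> "marginal n H0" "\<lambda>a x. act n x a"
    by (rule bi_invariant_action.intro) (simp_all add: sets_\<nu> sigma_finite_\<nu> sigma_finite n distr_\<nu>_right distr_\<nu>_left left
        distr_marginal_act meas_act)
  have sets_cong [measurable_cong]: "sets (marginal n H0) = sets (\<F> n)"
    using n by (rule sets_marginal)
  note [measurable (raw)] = measurable_posterior_density[OF n]
  have A_sets [measurable]: "A \<in> sets (\<F> n)" using A by (simp add: invariant_events_def)
  have equi: "equivariant (?w k)" for k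
    unfolding equivariant_def
  proof (intro conjI allI)
    show "(\<lambda>(g, x). ?w k g x) \<in> borel_measurable (\<nu> \<Otimes>\<^sub>M marginal n H0)" by measurable
    fix g a
    note [measurable] = measurable_act[OF n]
    have "density (marginal n H0) (\<lambda>x. ?w k (g + a) (act n x a)) = density (marginal n H0) (?w k g)"
    proof (rule measure_eqI)
      fix B assume B: "B \<in> sets (density (marginal n H0) (\<lambda>x. ?w k (g + a) (act n x a)))"
      hence [measurable]: "B \<in> sets (\<F> n)" by (simp add: sets_cong)
      \<comment> \<open>the translate of \<open>B\<close> by \<open>a\<close>, which contains \<open>x \<cdot> a\<close> iff \<open>B\<close> contains \<open>x\<close>\<close>
      define C where "C = {x \<in> sample_space m S n. act n x (- a) \<in> B}"
      have [measurable]: "C \<in> sets (\<F> n)"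
        using measurable_sets[OF measurable_act[OF n], of B "- a"]
        by (simp add: C_def vimage_def Int_def conj_commute)
      have ind: "indicator B x = (indicator C (act n x a) :: ennreal)" if "x \<in> sample_space m S n" for x
        using that n by (simp add: C_def indicator_def act_act act_0 act_space)
      have "emeasure (density (marginal n H0) (\<lambda>x. ?w k (g + a) (act n x a))) B
          = (\<integral>\<^sup>+x. ?w k (g + a) (act n x a) * indicator B x \<partial>marginal n H0)"
      proof (rule emeasure_density)
        show "B \<in> sets (marginal n H0)" using B by simp
      qed measurable
      also have "\<dots> = (\<integral>\<^sup>+x. (\<lambda>x. ?w k (g + a) x * indicator C x) (act n x a) \<partial>marginal n H0)"
        by (intro nn_integral_cong) (simp only: ind space_marginal[OF n])
      also have "\<dots> = (\<integral>\<^sup>+x. ?w k (g + a) x * indicator C x \<partial>marginal n H0)"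
        by (rule nn_integral_T) measurable
      also have "\<dots> = emeasure (density (marginal n H0) (?w k (g + a))) C"
        by (rule emeasure_density[symmetric]) measurable
      also have "\<dots> = emeasure (P n k (g + a + - a)) B"
        unfolding density_marginal_posterior_density(1)[OF n] C_def
        by (rule emeasure_P_act[OF n]) measurable
      also have "\<dots> = emeasure (density (marginal n H0) (?w k g)) B"
        unfolding density_marginal_posterior_density(1)[OF n] by simp
      finally show "emeasure (density (marginal n H0) (\<lambda>x. ?w k (g + a) (act n x a))) B
          = emeasure (density (marginal n H0) (?w k g)) B" .
    qed simp
    thus "AE x in marginal n H0. ?w k (g + a) (act n x a) = ?w k g x"
      by (rule \<mu>.density_unique[rotated 2]) measurable
  qed
  have inv: "almost_invariant (indicator A)"
    unfolding almost_invariant_def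
    using emeasure_P_invariant_event(2)[OF n A]
    by (auto intro!: AE_I2 simp: space_marginal n indicator_def)
  have [measurable]: "\<beta> \<in> borel_measurable (\<F> n)"
    using \<beta> by (simp add: RN_version_def measurable_cong_sets[OF sets_cong refl])
  have "density (marginal n H0) (\<lambda>x. ennreal (\<beta> x))
      = density (marginal n H0) (\<lambda>x. \<integral>\<^sup>+h. ?w H1 h x \<partial>\<nu>)"
    using \<beta> density_marginal_posterior_density(2)[OF n, of H1] by (simp add: RN_version_def)
  hence \<beta>_eq: "AE x in marginal n H0. ennreal (\<beta> x) = (\<integral>\<^sup>+h. ?w H1 h x \<partial>\<nu>)"
    by (rule \<mu>.density_unique[rotated 2]) measurable
  have pos: "AE x in marginal n H0. ?w H0 0 x > 0"
  proof (rule absolutely_continuous_AE)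
    show "absolutely_continuous (P n H0 0) (marginal n H0)"
      using mutually_ac[OF n, of "P n H0 0" "marginal n H0"] by (auto simp: model_measures_def)
    show "AE x in P n H0 0. ?w H0 0 x > 0"
    proof -
      have "AE x in density (marginal n H0) (?w H0 0). ?w H0 0 x > 0"
        by (subst AE_density) auto
      thus ?thesis by (simp only: density_marginal_posterior_density(1)[OF n])
    qed
  qed (simp add: sets_cong sets_P n)
  have fin: "(\<integral>\<^sup>+x. ?w H0 0 x \<partial>marginal n H0) \<noteq> \<infinity>"
  proof -
    interpret P: prob_space "P n H0 0" using n by (rule prob_space_P)
    have "(\<integral>\<^sup>+x. ?w H0 0 x \<partial>marginal n H0) = emeasure (density (marginal n H0) (?w H0 0)) (space (marginal n H0))"
      by (subst emeasure_density) (auto intro!: nn_integral_cong)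
    also have "\<dots> = 1"
      unfolding density_marginal_posterior_density(1)[OF n] using P.emeasure_space_1
      by (simp add: space_P space_marginal n)
    finally show ?thesis by simp
  qed
  have mix: "AE x in marginal n H0. (\<integral>\<^sup>+h. ?w H0 h x \<partial>\<nu>) = 1"
    using posterior_normaliser(3)[OF n] by (intro AE_I2) (simp add: posterior_density_def space_marginal n)
  have "(\<integral>\<^sup>+x. indicator A x * ennreal (\<beta> x) \<partial>P n H0 g)
      = (\<integral>\<^sup>+x. indicator A x * ennreal (\<beta> x) \<partial>density (marginal n H0) (?w H0 g))"
    by (simp add: density_marginal_posterior_density(1) n)
  also have "\<dots> = (\<integral>\<^sup>+x. ?w H0 g x * (indicator A x * ennreal (\<beta> x)) \<partial>marginal n H0)"
    by (rule nn_integral_density) measurable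
  also have "\<dots> = (\<integral>\<^sup>+x. indicator A x * (\<integral>\<^sup>+h. ?w H1 h x \<partial>\<nu>) * ?w H0 g x \<partial>marginal n H0)"
    by (rule nn_integral_cong_AE, use \<beta>_eq in eventually_elim) (simp add: mult_ac)
  also have "\<dots> = (\<integral>\<^sup>+x. indicator A x * ?w H1 0 x \<partial>marginal n H0)"
    by (rule nn_integral_bayes_factor[OF equi equi inv mix pos fin])
  also have "\<dots> = emeasure (density (marginal n H0) (?w H1 0)) A"
    by (subst emeasure_density) (auto simp: mult.commute)
  also have "\<dots> = emeasure (P n H1 0) A"
    by (simp add: density_marginal_posterior_density(1) n)
  finally show ?thesis .
qed

end

section \<open>Stopping the process\<close>

lemma stopped_sums:
  "(\<lambda>i. indicator {\<omega>. \<tau> \<omega> = enat (m + 1 + i)} \<omega> * \<beta> (m + 1 + i) (observed X (m + 1 + i) \<omega>))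
     sums stopped m \<beta> X \<tau> \<omega>"
  unfolding stopped_def Let_def
proof (rule summable_sums, rule summable_finite)
  show "finite {i. \<tau> \<omega> = enat (m + 1 + i)}"
    by (rule finite_subset[of _ "{the_enat (\<tau> \<omega>) - m - 1}"]) auto
qed auto

context group_invariant_process
begin

lemma prob_space_Q: "prob_space (Q k g)"
  and sets_Q: "sets (Q k g) = sets \<Omega>"
  using measurable_space[OF kernel_Q, of g k] by (auto simp: space_prob_algebra)

lemma space_Q: "space (Q k g) = space \<Omega>"
  by (rule sets_eq_imp_space_eq) (rule sets_Q)

lemma measurable_observed_Q: "n \<ge> m \<Longrightarrow> observed X n \<in> Q k g \<rightarrow>\<^sub>M \<F> n"
  using measurable_observed by (simp add: measurable_cong_sets[OF sets_Q refl])

lemma emeasure_Q_observed: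
  assumes "n \<ge> m" "A \<in> sets (\<F> n)"
  shows "emeasure (Q k g) (observed X n -` A \<inter> space \<Omega>) = emeasure (P n k g) A"
  using assms by (simp add: distr_Q[of n k g, symmetric] emeasure_distr measurable_observed_Q space_Q)

lemma quotient_event_observed:
  assumes "n \<ge> m" "A \<in> invariant_events (\<F> n) (act n)"
  shows "emeasure (Q k g) (observed X n -` A \<inter> space \<Omega>) = emeasure (P n k 0) A"
    and "observed X n -` A \<inter> space \<Omega> \<in> sets \<Omega>"
proof -
  have A: "A \<in> sets (\<F> n)" using assms(2) by (simp add: invariant_events_def)
  show "emeasure (Q k g) (observed X n -` A \<inter> space \<Omega>) = emeasure (P n k 0) A"
    unfolding emeasure_Q_observed[OF assms(1) A] by (rule emeasure_P_invariant_event(1)[OF assms])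
  show "observed X n -` A \<inter> space \<Omega> \<in> sets \<Omega>"
    by (rule measurable_sets[OF measurable_observed[OF assms(1)] A])
qed

lemma sample_space_m: "sample_space m S m = S"
  using S_subset by (auto simp: sample_space_def extensional_restrict PiE_def)

lemma emeasure_Q_disintegration:
  assumes N: "N \<in> sets \<Omega>"
  shows "emeasure (Q k g) N = (\<integral>\<^sup>+x. emeasure (K k g x) N \<partial>P m k g)"
proof -
  have "N \<inter> observed X m -` space (\<F> m) = N"
    using measurable_space[OF measurable_observed[OF order_refl]] sets.sets_into_space[OF N] by auto
  hence "emeasure (Q k g) N = (\<integral>\<^sup>+x\<in>space (\<F> m). emeasure (K k g x) N \<partial>P m k g)"
    using conditional_K[OF N sets.top, of k g] by simp
  also have "\<dots> = (\<integral>\<^sup>+x. emeasure (K k g x) N \<partial>P m k g)"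
    by (intro nn_integral_cong) (simp add: space_P)
  finally show ?thesis .
qed

text \<open>
  The hypothesis concerns the mixture over the posterior at a fixed initial sample, the conclusion
  the members of the family. The posterior at \<open>x\<close> has density proportional to \<open>p m k g x\<close>, so for every
  \<open>x\<close> the product of \<open>p m k g x\<close> with the conditional probability of \<open>N\<close> vanishes for almost all \<open>g\<close>.
  Exchanging the two quantifiers, it vanishes for almost all \<open>g\<close> at almost all \<open>x\<close>, and integrating
  over \<open>x\<close> gives the unconditional probability.
\<close>

lemma AE_null_of_conditional_null:
  assumes N: "N \<in> sets \<Omega>"
    and null: "\<And>x. x \<in> S \<Longrightarrow> emeasure (conditional_marginal \<nu> (p m k) (K k) x) N = 0"
  shows "AE g in \<nu>. emeasure (Q k g) N = 0"
proof -
  interpret \<nu>: sigma_finite_measure \<nu> by (rule sigma_finite_\<nu>)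
  interpret \<rho>: sigma_finite_measure "\<rho> m" by (rule sigma_finite_\<rho>) simp
  interpret pair_sigma_finite \<nu> "\<rho> m" ..
  note [measurable (raw)] = measurable_p_compose[OF order_refl]
  have KN: "(\<lambda>(g, x). emeasure (K k g x) N) \<in> borel_measurable (\<nu> \<Otimes>\<^sub>M \<F> m)"
    using measurable_compose[OF measurable_prob_algebraD[OF kernel_K] measurable_emeasure_subprob_algebra[OF N], of k]
    by (simp add: case_prod_beta)
  have [measurable (raw)]: "(\<lambda>y. emeasure (K k (a y) (b y)) N) \<in> borel_measurable M"
    if "a \<in> M \<rightarrow>\<^sub>M \<nu>" "b \<in> M \<rightarrow>\<^sub>M \<F> m" for a b and M :: "'z measure"
    using measurable_compose[OF measurable_Pair[OF that] KN] by simp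
  have KN1: "(\<lambda>g. emeasure (K k g x) N) \<in> borel_measurable \<nu>" if "x \<in> S" for x
    using measurable_compose[OF measurable_Pair2'[of x "\<F> m" \<nu>] KN] that by (simp add: sample_space_m)
  have KN2: "(\<lambda>x. emeasure (K k g x) N) \<in> borel_measurable (\<F> m)" for g
    using measurable_compose[OF measurable_Pair1'[of g \<nu> "\<F> m"] KN] by simp
  have AE_g: "AE g in \<nu>. p m k g x * emeasure (K k g x) N = 0" if x: "x \<in> S" for x
  proof -
    let ?r = "\<integral>\<^sup>+h. p m k h x \<partial>\<nu>"
    have x': "x \<in> sample_space m S m" using x by (simp add: sample_space_m)
    hence [measurable]: "x \<in> space (\<F> m)" by simp
    note [measurable] = KN1[OF x]
    have "(\<lambda>g. K k g x) \<in> \<nu> \<rightarrow>\<^sub>M subprob_algebra \<Omega>"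
      using measurable_compose[OF measurable_Pair2'[of x "\<F> m" \<nu>] measurable_prob_algebraD[OF kernel_K], of k] x'
      by simp
    hence "(\<lambda>g. K k g x) \<in> posterior \<nu> (p m k) x \<rightarrow>\<^sub>M subprob_algebra \<Omega>"
      by (simp add: posterior_def)
    from emeasure_bind[OF _ this N]
    have "(\<integral>\<^sup>+g. emeasure (K k g x) N \<partial>posterior \<nu> (p m k) x) = 0"
      using null[OF x] by (simp add: conditional_marginal_def posterior_def)
    hence "(\<integral>\<^sup>+g. p m k g x / ?r * emeasure (K k g x) N \<partial>\<nu>) = 0"
      unfolding posterior_def by (subst (asm) nn_integral_density) measurable
    hence "AE g in \<nu>. p m k g x / ?r * emeasure (K k g x) N = 0"
      by (subst (asm) nn_integral_0_iff_AE) measurable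
    then show ?thesis
      by eventually_elim (use posterior_normaliser(2)[OF order_refl x', of k] in \<open>auto simp: ennreal_divide_eq_0_iff\<close>)
  qed
  have KN': "(\<lambda>(g, x). p m k g x * emeasure (K k g x) N) \<in> borel_measurable (\<nu> \<Otimes>\<^sub>M \<rho> m)"
    using borel_measurable_times_ennreal[OF measurable_p[OF order_refl] KN]
    by (simp add: case_prod_beta measurable_cong_sets[OF sets_pair_measure_cong[OF refl sets_\<rho>[OF order_refl]] refl])
  have "AE x in \<rho> m. AE g in \<nu>. p m k g x * emeasure (K k g x) N = 0"
    using sets_eq_imp_space_eq[OF sets_\<rho>[OF order_refl]]
    by (intro AE_I2 AE_g) (simp only: sample_space_m space_\<F>)
  hence "AE g in \<nu>. AE x in \<rho> m. p m k g x * emeasure (K k g x) N = 0"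
    by (subst AE_commute) (use KN' in measurable)
  then show ?thesis
  proof eventually_elim
    case (elim g)
    have [measurable]: "p m k g \<in> borel_measurable (\<rho> m)" "(\<lambda>x. emeasure (K k g x) N) \<in> borel_measurable (\<rho> m)"
      using measurable_p_compose[OF order_refl, of "\<lambda>_. g" "\<F> m" "\<lambda>x. x" k] KN2[of g]
      by (simp_all add: measurable_cong_sets[OF sets_\<rho>[OF order_refl] refl])
    have "emeasure (Q k g) N = (\<integral>\<^sup>+x. emeasure (K k g x) N \<partial>density (\<rho> m) (p m k g))"
      by (simp add: emeasure_Q_disintegration N density_p)
    also have "\<dots> = (\<integral>\<^sup>+x. p m k g x * emeasure (K k g x) N \<partial>\<rho> m)"
      by (rule nn_integral_density) measurable
    also have "\<dots> = (\<integral>\<^sup>+x. 0 \<partial>\<rho> m)"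
      by (rule nn_integral_cong_AE) (rule elim)
    finally show ?case by simp
  qed
qed

lemma not_AE_False_\<nu>: "\<not> (AE g in \<nu>. False)"
proof -
  have "emeasure \<nu> UNIV > 0" using haar by (auto simp: right_haar_measure_def)
  thus ?thesis by (simp add: AE_iff_null null_sets_def)
qed

context
  fixes \<tau> :: "'w \<Rightarrow> enat"
  assumes stopping: "is_stopping_time m S \<Omega> X \<tau>"
    and finite_stopping: "\<And>k x. x \<in> S \<Longrightarrow>
          emeasure (conditional_marginal \<nu> (p m k) (K k) x) {\<omega> \<in> space \<Omega>. \<tau> \<omega> = \<infinity>} = 0"
    and invariant_stopping: "\<And>n. n > m \<Longrightarrow>
          {\<omega> \<in> space \<Omega>. \<tau> \<omega> = enat n} \<in> quotient_events m S act \<Omega> X n"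
begin

lemma stopping_event:
  assumes "n > m"
  obtains A where "A \<in> invariant_events (\<F> n) (act n)"
    "{\<omega> \<in> space \<Omega>. \<tau> \<omega> = enat n} = observed X n -` A \<inter> space \<Omega>"
  using invariant_stopping[OF assms] by (auto simp: quotient_events_def)

lemma sets_stopping_event [measurable]: "{\<omega> \<in> space \<Omega>. \<tau> \<omega> = enat (Suc (m + i))} \<in> sets \<Omega>"
proof -
  have n: "Suc (m + i) \<ge> m" "Suc (m + i) > m" by auto
  from stopping_event[OF n(2)] obtain A where "A \<in> invariant_events (\<F> (Suc (m + i))) (act (Suc (m + i)))"
    "{\<omega> \<in> space \<Omega>. \<tau> \<omega> = enat (Suc (m + i))} = observed X (Suc (m + i)) -` A \<inter> space \<Omega>" .
  thus ?thesis using quotient_event_observed(2)[OF n(1)] by simp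
qed

lemma never_stopping_eq:
  "{\<omega> \<in> space \<Omega>. \<tau> \<omega> = \<infinity>} = space \<Omega> - (\<Union>i. {\<omega> \<in> space \<Omega>. \<tau> \<omega> = enat (Suc (m + i))})"
proof -
  have "\<tau> \<omega> = \<infinity> \<or> (\<exists>i. \<tau> \<omega> = enat (Suc (m + i)))" if \<omega>: "\<omega> \<in> space \<Omega>" for \<omega>
  proof (cases "\<tau> \<omega>")
    case (enat j)
    hence "m < j" using stopping \<omega> by (auto simp: is_stopping_time_def)
    hence "j = Suc (m + (j - Suc m))" by simp
    thus ?thesis using enat by metis
  qed simp
  thus ?thesis by fastforce
qed

text \<open>
  The assumption on the conditional marginals makes \<open>\<tau> = \<infinity>\<close> null only for almost every \<open>g\<close>. Since the events \<open>\<tau> = n\<close> are invariant,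
  their probabilities do not depend on \<open>g\<close>, so one good parameter \<open>h\<close> suffices.
\<close>

lemma stopping_probabilities_sum:
  "(\<Sum>i. emeasure (Q k g) {\<omega> \<in> space \<Omega>. \<tau> \<omega> = enat (Suc (m + i))}) = 1"
proof -
  let ?E = "\<lambda>i. {\<omega> \<in> space \<Omega>. \<tau> \<omega> = enat (Suc (m + i))}"
  let ?N = "{\<omega> \<in> space \<Omega>. \<tau> \<omega> = \<infinity>}"
  have N: "?N \<in> sets \<Omega>" unfolding never_stopping_eq by measurable
  have "AE h in \<nu>. emeasure (Q k h) ?N = 0"
    by (rule AE_null_of_conditional_null[OF N finite_stopping])
  hence "\<exists>h. emeasure (Q k h) ?N = 0"
  proof (rule contrapos_pp)
    assume "\<not> (\<exists>h. emeasure (Q k h) ?N = 0)"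
    thus "\<not> (AE h in \<nu>. emeasure (Q k h) ?N = 0)"
      using not_AE_False_\<nu> by simp
  qed
  then obtain h where h: "emeasure (Q k h) ?N = 0" ..
  interpret prob_space "Q k h" by (rule prob_space_Q)
  have const: "emeasure (Q k g) (?E i) = emeasure (Q k h) (?E i)" for i
  proof -
    have i: "Suc (m + i) > m" by simp
    from stopping_event[OF i] obtain A where A: "A \<in> invariant_events (\<F> (Suc (m + i))) (act (Suc (m + i)))"
      "?E i = observed X (Suc (m + i)) -` A \<inter> space \<Omega>" .
    show ?thesis unfolding A(2) by (simp add: quotient_event_observed(1)[OF _ A(1)])
  qed
  have "(\<Sum>i. emeasure (Q k g) (?E i)) = (\<Sum>i. emeasure (Q k h) (?E i))"
    by (simp only: const)
  also have "\<dots> = emeasure (Q k h) (\<Union>i. ?E i)"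
    by (rule suminf_emeasure) (auto simp: disjoint_family_on_def sets_Q)
  also have "\<dots> = emeasure (Q k h) (space (Q k h))"
  proof (rule emeasure_eq_AE)
    have "AE \<omega> in Q k h. \<omega> \<notin> ?N"
      by (rule AE_not_in) (use h N in \<open>simp add: null_sets_def sets_Q\<close>)
    thus "AE \<omega> in Q k h. \<omega> \<in> (\<Union>i. ?E i) \<longleftrightarrow> \<omega> \<in> space (Q k h)"
      using AE_space by eventually_elim (unfold never_stopping_eq space_Q, blast)
  qed (auto simp: sets_Q space_Q)
  also have "\<dots> = 1" by (rule emeasure_space_1)
  finally show ?thesis .
qed

context
  fixes \<beta> :: "nat \<Rightarrow> (nat \<Rightarrow> 'x) \<Rightarrow> real"
  assumes left: "left_invariant \<nu>"
    and bayes_factor: "\<And>n. n \<ge> m \<Longrightarrow> RN_version (marginal n H0) (marginal n H1) (\<beta> n)"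
begin

lemma measurable_bayes_factor: "n \<ge> m \<Longrightarrow> \<beta> n \<in> borel_measurable (\<F> n)"
  using bayes_factor[of n] by (simp add: RN_version_def measurable_cong_sets[OF sets_marginal refl])

lemma bayes_factor_observed_nonneg:
  assumes "\<omega> \<in> space \<Omega>" "n \<ge> m"
  shows "\<beta> n (observed X n \<omega>) \<ge> 0"
  using bayes_factor[OF assms(2)] measurable_space[OF measurable_observed[OF assms(2)] assms(1)] assms(2)
  by (simp add: RN_version_def space_marginal)

lemma measurable_bayes_factor_observed:
  "n \<ge> m \<Longrightarrow> (\<lambda>\<omega>. \<beta> n (observed X n \<omega>)) \<in> borel_measurable \<Omega>"
  by (rule measurable_compose[OF measurable_observed measurable_bayes_factor])

lemma stopped_nonneg: "\<omega> \<in> space \<Omega> \<Longrightarrow> stopped m \<beta> X \<tau> \<omega> \<ge> 0"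
  by (rule sums_le[OF _ sums_zero stopped_sums]) (simp add: bayes_factor_observed_nonneg)

lemma measurable_stopped: "stopped m \<beta> X \<tau> \<in> borel_measurable \<Omega>"
proof -
  note [measurable] = measurable_bayes_factor_observed
  have "stopped m \<beta> X \<tau> \<in> borel_measurable \<Omega> \<longleftrightarrow>
    (\<lambda>\<omega>. \<Sum>i. indicator {\<omega> \<in> space \<Omega>. \<tau> \<omega> = enat (Suc (m + i))} \<omega>
        * \<beta> (Suc (m + i)) (observed X (Suc (m + i)) \<omega>)) \<in> borel_measurable \<Omega>"
    unfolding stopped_def Let_def
    by (intro measurable_cong suminf_cong) (simp add: indicator_def)
  also have "\<dots>" by measurable
  finally show ?thesis .
qed

text \<open>
  Each event \<open>\<tau> = j\<close> contributes its probability under \<open>H1\<close>, because the Bayes factor acts as a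
  likelihood ratio there; these probabilities add up to \<open>1\<close>.
\<close>

lemma nn_integral_stopped: "(\<integral>\<^sup>+\<omega>. ennreal (stopped m \<beta> X \<tau> \<omega>) \<partial>Q H0 g) = 1"
proof -
  let ?E = "\<lambda>i. {\<omega> \<in> space \<Omega>. \<tau> \<omega> = enat (Suc (m + i))}"
  let ?b = "\<lambda>i \<omega>. \<beta> (Suc (m + i)) (observed X (Suc (m + i)) \<omega>)"
  note [measurable_cong] = sets_Q
  have [measurable]: "?b i \<in> borel_measurable \<Omega>" for i
    by (rule measurable_bayes_factor_observed) simp
  have "ennreal (stopped m \<beta> X \<tau> \<omega>) = (\<Sum>i. indicator (?E i) \<omega> * ennreal (?b i \<omega>))"
    if "\<omega> \<in> space \<Omega>" for \<omega>
  proof -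
    have "(\<Sum>i. ennreal (indicator {\<omega>. \<tau> \<omega> = enat (m + 1 + i)} \<omega> * \<beta> (m + 1 + i) (observed X (m + 1 + i) \<omega>)))
        = ennreal (stopped m \<beta> X \<tau> \<omega>)"
      by (rule suminf_ennreal_eq[OF _ stopped_sums]) (simp add: bayes_factor_observed_nonneg that)
    moreover have "ennreal (indicator {\<omega>. \<tau> \<omega> = enat (m + 1 + i)} \<omega> * \<beta> (m + 1 + i) (observed X (m + 1 + i) \<omega>))
        = indicator (?E i) \<omega> * ennreal (?b i \<omega>)" for i
      using that by (cases "\<tau> \<omega> = enat (Suc (m + i))") simp_all
    ultimately show ?thesis by simp
  qed
  hence "(\<integral>\<^sup>+\<omega>. ennreal (stopped m \<beta> X \<tau> \<omega>) \<partial>Q H0 g)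
      = (\<integral>\<^sup>+\<omega>. (\<Sum>i. indicator (?E i) \<omega> * ennreal (?b i \<omega>)) \<partial>Q H0 g)"
    by (intro nn_integral_cong) (simp add: space_Q)
  also have "\<dots> = (\<Sum>i. \<integral>\<^sup>+\<omega>. indicator (?E i) \<omega> * ennreal (?b i \<omega>) \<partial>Q H0 g)"
    by (rule nn_integral_suminf) measurable
  also have "\<dots> = (\<Sum>i. emeasure (Q H1 0) (?E i))"
  proof (rule suminf_cong)
    fix i
    let ?n = "Suc (m + i)"
    have n: "?n \<ge> m" "?n > m" by auto
    from stopping_event[OF n(2)] obtain A where A: "A \<in> invariant_events (\<F> ?n) (act ?n)"
      "?E i = observed X ?n -` A \<inter> space \<Omega>" .
    have A': "A \<in> sets (\<F> ?n)" using A(1) by (simp add: invariant_events_def)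
    note [measurable] = measurable_bayes_factor[OF n(1)] A'
    have "(\<integral>\<^sup>+\<omega>. indicator (?E i) \<omega> * ennreal (?b i \<omega>) \<partial>Q H0 g)
        = (\<integral>\<^sup>+\<omega>. (\<lambda>x. indicator A x * ennreal (\<beta> ?n x)) (observed X ?n \<omega>) \<partial>Q H0 g)"
      unfolding A(2) by (intro nn_integral_cong) (simp add: space_Q indicator_def)
    also have "\<dots> = (\<integral>\<^sup>+x. indicator A x * ennreal (\<beta> ?n x) \<partial>P ?n H0 g)"
      unfolding distr_Q[OF n(1), of H0 g, symmetric]
      by (rule nn_integral_distr[symmetric, OF measurable_observed_Q[OF n(1)]]) measurable
    also have "\<dots> = emeasure (P ?n H1 0) A"
      by (rule integral_bayes_factor_invariant_event[OF n(1) left bayes_factor[OF n(1)] A(1)])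
    also have "\<dots> = emeasure (Q H1 0) (?E i)"
      unfolding A(2) by (rule quotient_event_observed(1)[OF n(1) A(1), symmetric])
    finally show "(\<integral>\<^sup>+\<omega>. indicator (?E i) \<omega> * ennreal (?b i \<omega>) \<partial>Q H0 g) = emeasure (Q H1 0) (?E i)" .
  qed
  also have "\<dots> = 1" by (rule stopping_probabilities_sum)
  finally show ?thesis .
qed

end
end
end

text \<open>
  Restricting the law to the positive half-line discards only the value \<open>0\<close>, which does not
  contribute to the integral.
\<close>

lemma integral_positive_law:
  assumes [measurable]: "B \<in> borel_measurable M" and nonneg: "\<And>\<omega>. \<omega> \<in> space M \<Longrightarrow> 0 \<le> B \<omega>"
  shows "(LINT c|positive_law M B. c) = (LINT \<omega>|M. B \<omega>)"
proof -
  have "(LINT c|positive_law M B. c) = (LINT c|distr M borel B. indicator {0<..} c *\<^sub>R c)"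
    unfolding positive_law_def by (rule integral_restrict_space) simp
  also have "\<dots> = (LINT \<omega>|M. indicator {0<..} (B \<omega>) *\<^sub>R B \<omega>)"
    by (rule integral_distr) measurable
  also have "\<dots> = (LINT \<omega>|M. B \<omega>)"
    using nonneg by (intro Bochner_Integration.integral_cong) (auto simp: indicator_def order_le_less)
  finally show ?thesis .
qed

text \<open>
  Markov's inequality at the level \<open>1 / \<alpha>\<close>, in a multiplicative form that includes \<open>\<alpha> = 0\<close>. Since
  \<open>1 / 0 = \<infinity>\<close>, the event excludes the zeros of \<open>B\<close>.
\<close>

lemma (in prob_space) markov_reciprocal:
  assumes [measurable]: "B \<in> borel_measurable M"
    and mean: "(\<integral>\<^sup>+\<omega>. ennreal (B \<omega>) \<partial>M) = 1" and \<alpha>: "0 \<le> \<alpha>"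
  shows "measure M {\<omega> \<in> space M. 1 / ennreal (B \<omega>) \<le> ennreal \<alpha>} \<le> \<alpha>"
proof -
  have "1 \<le> ennreal \<alpha> * ennreal (B \<omega>)" if le: "1 / ennreal (B \<omega>) \<le> ennreal \<alpha>" for \<omega>
  proof -
    have "ennreal (B \<omega>) \<noteq> 0" using le by (auto simp: divide_ennreal_def top_unique)
    hence "1 = 1 / ennreal (B \<omega>) * ennreal (B \<omega>)"
      using ennreal_divide_self[of "ennreal (B \<omega>)"] by (simp add: divide_ennreal_def mult.commute)
    also have "\<dots> \<le> ennreal \<alpha> * ennreal (B \<omega>)" using le by (rule mult_right_mono) simp
    finally show ?thesis .
  qed
  hence "emeasure M {\<omega> \<in> space M. 1 / ennreal (B \<omega>) \<le> ennreal \<alpha>}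
      \<le> emeasure M {\<omega> \<in> space M. 1 \<le> ennreal \<alpha> * ennreal (B \<omega>)}"
    by (intro emeasure_mono) auto
  also have "\<dots> \<le> ennreal \<alpha> * (\<integral>\<^sup>+\<omega>. ennreal (B \<omega>) * indicator (space M) \<omega> \<partial>M)"
    using nn_integral_Markov_inequality[of "\<lambda>\<omega>. ennreal (B \<omega>)" "space M" M "ennreal \<alpha>"]
    by (simp add: Int_def)
  also have "\<dots> = ennreal \<alpha>" using mean by (simp cong: nn_integral_cong)
  finally show ?thesis
    using \<alpha> by (simp add: emeasure_eq_measure)
qed

theorem theorem9:
  fixes m :: nat
    and S :: "(nat \<Rightarrow> 'x::t2_space) set"
    and act :: "nat \<Rightarrow> (nat \<Rightarrow> 'x) \<Rightarrow> 'g::{topological_group_add, t2_space} \<Rightarrow> (nat \<Rightarrow> 'x)"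
    and \<nu> :: "'g measure"
    and P :: "nat \<Rightarrow> hypothesis \<Rightarrow> 'g \<Rightarrow> (nat \<Rightarrow> 'x) measure"
    and \<rho> :: "nat \<Rightarrow> (nat \<Rightarrow> 'x) measure"
    and p :: "nat \<Rightarrow> hypothesis \<Rightarrow> 'g \<Rightarrow> (nat \<Rightarrow> 'x) \<Rightarrow> ennreal"
    and \<Omega> :: "'w measure"
    and X :: "nat \<Rightarrow> 'w \<Rightarrow> 'x"
    and Q :: "hypothesis \<Rightarrow> 'g \<Rightarrow> 'w measure"
    and K :: "hypothesis \<Rightarrow> 'g \<Rightarrow> (nat \<Rightarrow> 'x) \<Rightarrow> 'w measure"
    and \<beta> :: "nat \<Rightarrow> (nat \<Rightarrow> 'x) \<Rightarrow> real"
    and \<tau> :: "'w \<Rightarrow> enat"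
  assumes process: "group_invariant_process m S act \<nu> P \<rho> p \<Omega> X Q K"
    and unimodular: "left_invariant \<nu>"
    and bayes_factor: "\<And>n. n \<ge> m \<Longrightarrow>
          RN_version (bayes_marginal \<nu> (P n H0)) (bayes_marginal \<nu> (P n H1)) (\<beta> n)"
    and stopping: "is_stopping_time m S \<Omega> X \<tau>"
    and finite_stopping: "\<And>k x. x \<in> S \<Longrightarrow>
          emeasure (conditional_marginal \<nu> (p m k) (K k) x) {\<omega> \<in> space \<Omega>. \<tau> \<omega> = \<infinity>} = 0"
    and invariant_stopping: "\<And>n. n > m \<Longrightarrow>
          {\<omega> \<in> space \<Omega>. \<tau> \<omega> = enat n} \<in> quotient_events m S act \<Omega> X n"
  shows "(\<forall>g. (LINT \<omega>|Q H0 g. stopped m \<beta> X \<tau> \<omega>)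
               = (LINT c|positive_law (Q H0 g) (stopped m \<beta> X \<tau>). c)
           \<and> (LINT c|positive_law (Q H0 g) (stopped m \<beta> X \<tau>). c) = 1)
    \<and> (\<forall>g. \<forall>\<alpha>::real. 0 \<le> \<alpha> \<and> \<alpha> \<le> 1 \<longrightarrow>
           measure (Q H0 g)
             {\<omega> \<in> space \<Omega>. 1 / ennreal (stopped m \<beta> X \<tau> \<omega>) \<le> ennreal \<alpha>} \<le> \<alpha>)"
proof -
  interpret group_invariant_process m S act \<nu> P \<rho> p \<Omega> X Q K by (rule process)
  let ?B = "stopped m \<beta> X \<tau>"
  note stop = stopping finite_stopping invariant_stopping unimodular bayes_factor
  have meas [measurable]: "?B \<in> borel_measurable (Q H0 g)" for g
    using measurable_stopped[OF stop] by (simp add: measurable_cong_sets[OF sets_Q refl])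
  have nonneg: "0 \<le> ?B \<omega>" if "\<omega> \<in> space (Q H0 g)" for \<omega> g
    using stopped_nonneg[OF stop] that by (simp add: space_Q)
  have nn: "(\<integral>\<^sup>+\<omega>. ennreal (?B \<omega>) \<partial>Q H0 g) = 1" for g
    by (rule nn_integral_stopped[OF stop])
  have mean: "(LINT \<omega>|Q H0 g. ?B \<omega>) = 1" for g
    by (subst integral_eq_nn_integral) (auto simp: nn nonneg)
  show ?thesis
  proof (intro conjI allI impI)
    fix g
    show "(LINT \<omega>|Q H0 g. ?B \<omega>) = (LINT c|positive_law (Q H0 g) ?B. c)"
      "(LINT c|positive_law (Q H0 g) ?B. c) = 1"
      using integral_positive_law[OF meas nonneg] mean by simp_all
  next
    fix g and \<alpha> :: real
    assume \<alpha>: "0 \<le> \<alpha> \<and> \<alpha> \<le> 1"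
    interpret prob_space "Q H0 g" by (rule prob_space_Q)
    show "measure (Q H0 g) {\<omega> \<in> space \<Omega>. 1 / ennreal (?B \<omega>) \<le> ennreal \<alpha>} \<le> \<alpha>"
      using markov_reciprocal[OF meas nn] \<alpha> by (simp add: space_Q)
  qed
qed

end
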